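(* Let $X\subset\mathbb{Q}_p$ be a compact open set and let $f=P/Q:X\to X$ be a locally $1$-Lipschitz rational function such that $f'(x)$ has no roots in $X$. Let $t_0$ be the intrinsic level of $f$ (with respect to a fixed admissible $l$ and a fixed choice of representatives), let $t\le t_0$ be an integer, let $K$ be the union of any collection of cycles in $G(f,p^t)$, and let $Y=\widetilde{K}$. Then $f|_Y:Y\to Y$ is measure-preserving if and only if $Y=\widetilde{K'}$ for some $K'$ that is a union of a collection of cycles in $G(f,p^{t-1})$.
   Context: $|\cdot|$ is the $p$-adic absolute value, $B_r(a)=\{x\in\mathbb{Q}_p:|x-a|\le r\}$, $\mu$ is Haar measure with $\mu(B_{p^k}(a))=p^k$. A rational function $f:X\to X$ means $f=P/Q$ with $P,Q\in\mathbb{Z}_p[x]$ coprime (fixed), $Q$ without roots in $X$, $f(X)\subset X$. Locally $1$-Lipschitz: for every $a\in X$ there is $r>0$ with $|f(x)-f(y)|\le|x-y|$ on $B_r(a)$ (equivalently $|f'(a)|\le1$ for all $a\in X$). Measure-preserving: $\mu(f^{-1}(A))=\mu(A)$ for all Borel sets $A$. Admissible $l$: an integer such that for all $a\in X$, $B_{p^l}(a)\subset X$ and $|f(x)-f(y)|=|f'(a)|\,|x-y|$ for all $x,y\in B_{p^l}(a)$. For an integer $t\le l$ write $X=\bigsqcup_{i=1}^m D_{t,i}$ ($m=m(t)$) as a disjoint union of closed balls of radius $p^t$. Digraph $G(f,p^t)$: vertices $A_{t,1},\dots,A_{t,m}$, with an edge $(A_{t,i},A_{t,j})$ iff $f(D_{t,i})\subset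 D_{t,j}$. Each vertex has outdegree $1$; loops count as cycles of length $1$. For a subgraph $K$ of $G(f,p^t)$, $\widetilde{K}$ is the union of the balls $D_{t,i}$ corresponding to the vertices of $K$. Representatives: for each $t\le l$ a set $S_t=\{a_{t,1},\dots,a_{t,m}\}$ with $a_{t,i}\in D_{t,i}$, chosen so that $S_l\subset S_{l-1}\subset S_{l-2}\subset\cdots$. Subsidiary digraph $G^{\ast}(f,p^t)$: same vertices as $G(f,p^t)$; $(A_{t,i},A_{t,j})$ is an edge iff $f(D_{t,i})\subset D_{t,j}$ and, with $s$ the least non-negative integer such that $P(p^sx+a_{t,i})-(p^sy+a_{t,j})Q(p^sx+a_{t,i})\in\mathbb{Z}_p[x,y]$, $$p^t<\min\left\{p^{-s},\ p^l|f'(a_{t,i})|,\ \frac{|Q(a_{t,i})|\,|f'(a_{t,i})|}{|Q'(a_{t,i})|},\ p^{-2s}|Q(a_{t,i})|\,|f'(a_{t,i})|^2\right\}.$$ Conventions: the third term is $+\infty$ if $Q'(a_{t,i})=0$; if no such $s$ exists, there is no edge. Intrinsic level $t_0$: the largest integer $t\le l$ with $G(f,p^t)=G^{\ast}(f,p^t)$ (it exists when $f'$ has no root in $X$). *)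

theory Defs
  imports
    "HOL-Analysis.Analysis"
    "HOL-Computational_Algebra.Computational_Algebra"
    "Graph_Theory.Pair_Digraph"
    "Graph_Theory.Arc_Walk"
begin

section \<open>The \<open>p\<close>-adic absolute value on the rationals\<close>

definition padic_abs :: "nat \<Rightarrow> rat \<Rightarrow> real" where
  "padic_abs p x =
     (if x = 0 then 0
      else real p powi (int (multiplicity (int p) (snd (quotient_of x)))
                      - int (multiplicity (int p) (fst (quotient_of x)))))"

context
  fixes p :: nat
  assumes p: "prime p"
begin

lemma prime_elem_int_p: "prime_elem (int p)"
  using p by (simp add: prime_imp_prime_elem)

lemma real_p_gt_1: "real p > 1"
  using p prime_gt_1_nat by auto

lemma padic_abs_0 [simp]: "padic_abs p 0 = 0"
  by (simp add: padic_abs_def)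

lemma padic_abs_of_int_div:
  assumes "a \<noteq> 0" "b \<noteq> 0"
  shows "padic_abs p (of_int a / of_int b) =
           real p powi (int (multiplicity (int p) b) - int (multiplicity (int p) a))"
proof -
  define n d where "n = fst (quotient_of (of_int a / of_int b))"
    and "d = snd (quotient_of (of_int a / of_int b))"
  have q: "quotient_of (of_int a / of_int b) = (n, d)"
    by (simp add: n_def d_def)
  have d: "d > 0" using quotient_of_denom_pos[OF q] .
  have eq: "(of_int a :: rat) / of_int b = of_int n / of_int d"
    using quotient_of_div[OF q] .
  hence "(of_int (a * d) :: rat) = of_int (n * b)"
    using assms d by (simp add: field_simps)
  hence ad: "a * d = n * b" by (simp only: of_int_eq_iff)
  have n: "n \<noteq> 0" using ad assms d by auto
  have "multiplicity (int p) (a * d) = multiplicity (int p) (n * b)"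
    by (simp add: ad)
  hence "multiplicity (int p) a + multiplicity (int p) d
       = multiplicity (int p) n + multiplicity (int p) b"
    using assms n d prime_elem_int_p by (simp add: prime_elem_multiplicity_mult_distrib)
  hence "int (multiplicity (int p) d) - int (multiplicity (int p) n)
       = int (multiplicity (int p) b) - int (multiplicity (int p) a)"
    by linarith
  thus ?thesis
    using assms by (simp add: padic_abs_def q)
qed

lemma rat_as_frac:
  fixes x :: rat
  obtains a b :: int where "b \<noteq> 0" "x = of_int a / of_int b"
proof -
  obtain n d where q: "quotient_of x = (n, d)" by force
  show ?thesis
    using that[of d n] quotient_of_denom_pos[OF q] quotient_of_div[OF q] by simp
qed

lemma padic_abs_nonneg [simp]: "padic_abs p x \<ge> 0"
  by (simp add: padic_abs_def)

lemma padic_abs_eq_0_iff [simp]: "padic_abs p x = 0 \<longleftrightarrow> x = 0"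
  using real_p_gt_1 by (simp add: padic_abs_def)

lemma padic_abs_mult: "padic_abs p (x * y) = padic_abs p x * padic_abs p y"
proof (cases "x = 0 \<or> y = 0")
  case False
  obtain a b where x: "b \<noteq> 0" "x = of_int a / of_int b" by (rule rat_as_frac)
  obtain c d where y: "d \<noteq> 0" "y = of_int c / of_int d" by (rule rat_as_frac)
  have nz: "a \<noteq> 0" "c \<noteq> 0" using False x y by auto
  have "x * y = of_int (a * c) / of_int (b * d)" using x y by simp
  hence "padic_abs p (x * y) =
          real p powi (int (multiplicity (int p) (b * d)) - int (multiplicity (int p) (a * c)))"
    using padic_abs_of_int_div[of "a * c" "b * d"] nz x y by simp
  also have "int (multiplicity (int p) (b * d)) - int (multiplicity (int p) (a * c)) =
     (int (multiplicity (int p) b) - int (multiplicity (int p) a)) +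
     (int (multiplicity (int p) d) - int (multiplicity (int p) c))"
    using nz x y prime_elem_int_p by (simp add: prime_elem_multiplicity_mult_distrib)
  also have "real p powi \<dots> = padic_abs p x * padic_abs p y"
    using nz x y real_p_gt_1 by (simp add: padic_abs_of_int_div power_int_add)
  finally show ?thesis .
qed auto

lemma padic_abs_minus: "padic_abs p (- x) = padic_abs p x"
proof (cases "x = 0")
  case False
  obtain a b where x: "b \<noteq> 0" "x = of_int a / of_int b" by (rule rat_as_frac)
  have "- x = of_int (- a) / of_int b" using x by simp
  thus ?thesis
    using False x padic_abs_of_int_div[of "-a" b] padic_abs_of_int_div[of a b] by auto
qed auto

lemma padic_abs_1: "padic_abs p 1 = 1"
  using padic_abs_of_int_div[of 1 1] by simp

lemma padic_abs_add_le: "padic_abs p (x + y) \<le> max (padic_abs p x) (padic_abs p y)"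
proof (cases "x = 0 \<or> y = 0 \<or> x + y = 0")
  case True
  thus ?thesis by (auto simp: max_def)
next
  case False
  obtain a b where x: "b \<noteq> 0" "x = of_int a / of_int b" by (rule rat_as_frac)
  obtain c d where y: "d \<noteq> 0" "y = of_int c / of_int d" by (rule rat_as_frac)
  define A C where "A = a * d" and "C = c * b"
  have x': "x = of_int A / of_int (b * d)" and y': "y = of_int C / of_int (b * d)"
    using x y by (simp_all add: A_def C_def)
  have xy': "x + y = of_int (A + C) / of_int (b * d)"
    unfolding x' y' by (simp add: add_divide_distrib)
  have nz: "A \<noteq> 0" "C \<noteq> 0" "A + C \<noteq> 0" "b * d \<noteq> 0"
    using False x' y' xy' x y by (auto simp del: of_int_add of_int_mult)
  let ?m = "\<lambda>z. multiplicity (int p) z"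
  have "int p ^ min (?m A) (?m C) dvd A + C"
    by (intro dvd_add) (meson dvd_trans le_imp_power_dvd min.cobounded1 min.cobounded2 multiplicity_dvd)+
  hence "min (?m A) (?m C) \<le> ?m (A + C)"
    using nz prime_elem_int_p by (intro multiplicity_geI) (auto simp: prime_elem_def)
  hence *: "int (?m (b * d)) - int (?m (A + C)) \<le> int (?m (b * d)) - int (?m A) \<or>
            int (?m (b * d)) - int (?m (A + C)) \<le> int (?m (b * d)) - int (?m C)"
    by linarith
  have "real p powi (int (?m (b * d)) - int (?m (A + C))) \<le>
     max (real p powi (int (?m (b * d)) - int (?m A))) (real p powi (int (?m (b * d)) - int (?m C)))"
    using * real_p_gt_1 power_int_increasing[of _ _ "real p"]
    by (smt (verit, best) max.coboundedI1 max.coboundedI2)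
  thus ?thesis
    using nz
    by (simp only: xy', simp only: x' y' padic_abs_of_int_div[of A "b * d"] padic_abs_of_int_div[of C "b * d"]
          padic_abs_of_int_div[of "A + C" "b * d"] simp_thms)
qed

lemma padic_abs_diff_commute: "padic_abs p (x - y) = padic_abs p (y - x)"
  using padic_abs_minus[of "x - y"] by simp

lemma padic_abs_triangle: "padic_abs p (x + y) \<le> padic_abs p x + padic_abs p y"
  using padic_abs_add_le[of x y] padic_abs_nonneg[of x] padic_abs_nonneg[of y] by linarith

lemma padic_abs_abs_diff_le: "\<bar>padic_abs p x - padic_abs p y\<bar> \<le> padic_abs p (x - y)"
  using padic_abs_triangle[of "x - y" y] padic_abs_triangle[of "y - x" x]
  by (simp add: padic_abs_diff_commute[of y x] abs_le_iff)

lemma padic_abs_inverse: "padic_abs p (inverse x) = inverse (padic_abs p x)"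
proof (cases "x = 0")
  case False
  have "padic_abs p x * padic_abs p (inverse x) = 1"
    using False padic_abs_mult[of x "inverse x"] padic_abs_1 by simp
  thus ?thesis by (simp add: inverse_unique)
qed simp

end

section \<open>The field \<open>\<rat>\<^sub>p\<close> as the completion of the rationals\<close>

text \<open>
  The prime \<open>p\<close> is carried by a type variable \<open>'p\<close> with \<open>p = CARD('p)\<close>, in the same way as
  the dimension of \<open>real ^ 'n\<close>.
\<close>

class prime_card = finite +
  assumes prime_card: "prime CARD('a)"

definition padic_cauchy :: "nat \<Rightarrow> (nat \<Rightarrow> rat) \<Rightarrow> bool" where
  "padic_cauchy p X \<longleftrightarrow> (\<forall>e>0. \<exists>N. \<forall>m\<ge>N. \<forall>n\<ge>N. padic_abs p (X m - X n) < e)"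

lemma padic_cauchyD:
  assumes "padic_cauchy p X" "e > 0"
  obtains N where "\<And>m n. m \<ge> N \<Longrightarrow> n \<ge> N \<Longrightarrow> padic_abs p (X m - X n) < e"
  using assms unfolding padic_cauchy_def by blast

context
  fixes p :: nat
  assumes p: "prime p"
begin

lemma padic_cauchy_const: "padic_cauchy p (\<lambda>_. c)"
  using p by (simp add: padic_cauchy_def)

lemma padic_cauchy_minus:
  assumes "padic_cauchy p X" shows "padic_cauchy p (\<lambda>n. - X n)"
proof -
  have "padic_abs p (- X m - - X n) = padic_abs p (X m - X n)" for m n
    using padic_abs_minus[OF p, of "X m - X n"] by (simp add: algebra_simps)
  thus ?thesis using assms by (simp add: padic_cauchy_def)
qed

lemma padic_cauchy_add:
  assumes "padic_cauchy p X" "padic_cauchy p Y" shows "padic_cauchy p (\<lambda>n. X n + Y n)"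
  unfolding padic_cauchy_def
proof (intro allI impI)
  fix e :: real assume e: "e > 0"
  obtain M where M: "\<And>m n. m \<ge> M \<Longrightarrow> n \<ge> M \<Longrightarrow> padic_abs p (X m - X n) < e"
    using padic_cauchyD[OF assms(1) e] by blast
  obtain N where N: "\<And>m n. m \<ge> N \<Longrightarrow> n \<ge> N \<Longrightarrow> padic_abs p (Y m - Y n) < e"
    using padic_cauchyD[OF assms(2) e] by blast
  have "padic_abs p (X m + Y m - (X n + Y n)) < e" if "m \<ge> max M N" "n \<ge> max M N" for m n
    using padic_abs_add_le[OF p, of "X m - X n" "Y m - Y n"] M[of m n] N[of m n] that
    by (simp add: algebra_simps)
  thus "\<exists>N. \<forall>m\<ge>N. \<forall>n\<ge>N. padic_abs p (X m + Y m - (X n + Y n)) < e" by blast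
qed

lemma padic_cauchy_diff:
  assumes "padic_cauchy p X" "padic_cauchy p Y" shows "padic_cauchy p (\<lambda>n. X n - Y n)"
  using padic_cauchy_add[OF assms(1) padic_cauchy_minus[OF assms(2)]] by simp

lemma padic_cauchy_convergent:
  assumes "padic_cauchy p X" shows "convergent (\<lambda>n. padic_abs p (X n))"
proof (rule Cauchy_convergent, rule CauchyI)
  fix e :: real assume "e > 0"
  then obtain N where N: "\<And>m n. m \<ge> N \<Longrightarrow> n \<ge> N \<Longrightarrow> padic_abs p (X m - X n) < e"
    using padic_cauchyD[OF assms] by blast
  have "norm (padic_abs p (X m) - padic_abs p (X n)) < e" if "m \<ge> N" "n \<ge> N" for m n
    using N[OF that] padic_abs_abs_diff_le[OF p, of "X m" "X n"] by simp
  thus "\<exists>M. \<forall>m\<ge>M. \<forall>n\<ge>M. norm (padic_abs p (X m) - padic_abs p (X n)) < e" by blast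
qed

lemma padic_cauchy_bounded:
  assumes "padic_cauchy p X" obtains B where "B > 0" "\<And>n. padic_abs p (X n) \<le> B"
proof -
  have "Bseq (\<lambda>n. padic_abs p (X n))"
    using padic_cauchy_convergent[OF assms] by (rule convergent_imp_Bseq)
  then obtain B where "B > 0" "\<And>n. norm (padic_abs p (X n)) \<le> B"
    by (auto simp: Bseq_def)
  thus ?thesis using that[of B] padic_abs_nonneg[OF p] by auto
qed

lemma padic_cauchy_mult:
  assumes "padic_cauchy p X" "padic_cauchy p Y" shows "padic_cauchy p (\<lambda>n. X n * Y n)"
  unfolding padic_cauchy_def
proof (intro allI impI)
  fix e :: real assume e: "e > 0"
  obtain A where A: "A > 0" "\<And>n. padic_abs p (X n) \<le> A" using padic_cauchy_bounded[OF assms(1)] by blast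
  obtain B where B: "B > 0" "\<And>n. padic_abs p (Y n) \<le> B" using padic_cauchy_bounded[OF assms(2)] by blast
  obtain M where M: "\<And>m n. m \<ge> M \<Longrightarrow> n \<ge> M \<Longrightarrow> padic_abs p (X m - X n) < e / B"
    using padic_cauchyD[OF assms(1), of "e / B"] e B(1) by auto
  obtain N where N: "\<And>m n. m \<ge> N \<Longrightarrow> n \<ge> N \<Longrightarrow> padic_abs p (Y m - Y n) < e / A"
    using padic_cauchyD[OF assms(2), of "e / A"] e A(1) by auto
  have "padic_abs p (X m * Y m - X n * Y n) < e" if mn: "m \<ge> max M N" "n \<ge> max M N" for m n
  proof -
    have eq: "X m * Y m - X n * Y n = X m * (Y m - Y n) + (X m - X n) * Y n"
      by (simp add: algebra_simps)
    have "padic_abs p (X m) * padic_abs p (Y m - Y n) \<le> A * padic_abs p (Y m - Y n)"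
      using A p by (intro mult_right_mono) auto
    also have "\<dots> < A * (e / A)"
      using A N[of m n] mn by (intro mult_strict_left_mono) auto
    finally have 1: "padic_abs p (X m * (Y m - Y n)) < e"
      using A by (simp add: padic_abs_mult[OF p])
    have "padic_abs p (X m - X n) * padic_abs p (Y n) \<le> padic_abs p (X m - X n) * B"
      using B p by (intro mult_left_mono) auto
    also have "\<dots> < (e / B) * B"
      using B M[of m n] mn by (intro mult_strict_right_mono) auto
    finally have 2: "padic_abs p ((X m - X n) * Y n) < e"
      using B by (simp add: padic_abs_mult[OF p])
    show ?thesis
      unfolding eq using 1 2 padic_abs_add_le[OF p] by (meson le_less_trans max_less_iff_conj)
  qed
  thus "\<exists>N. \<forall>m\<ge>N. \<forall>n\<ge>N. padic_abs p (X m * Y m - X n * Y n) < e" by blast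
qed

lemma padic_cauchy_inverse:
  assumes "padic_cauchy p X" and nz: "lim (\<lambda>n. padic_abs p (X n)) \<noteq> 0"
  shows "padic_cauchy p (\<lambda>n. inverse (X n))"
  unfolding padic_cauchy_def
proof (intro allI impI)
  fix e :: real assume e: "e > 0"
  define L where "L = lim (\<lambda>n. padic_abs p (X n))"
  have lim: "(\<lambda>n. padic_abs p (X n)) \<longlonglongrightarrow> L"
    using padic_cauchy_convergent[OF assms(1)] by (simp add: L_def convergent_LIMSEQ_iff)
  have "L \<ge> 0" using p by (intro LIMSEQ_le_const[OF lim]) auto
  hence L: "L > 0" using nz by (simp add: L_def)
  hence "eventually (\<lambda>n. padic_abs p (X n) > L / 2) sequentially"
    by (intro order_tendstoD(1)[OF lim]) auto
  then obtain K where K: "\<And>n. n \<ge> K \<Longrightarrow> padic_abs p (X n) > L / 2"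
    by (auto simp: eventually_sequentially)
  have e': "e * (L / 2) * (L / 2) > 0" using e L by simp
  obtain N where N: "\<And>m n. m \<ge> N \<Longrightarrow> n \<ge> N \<Longrightarrow> padic_abs p (X m - X n) < e * (L / 2) * (L / 2)"
    using padic_cauchyD[OF assms(1) e'] by blast
  have "padic_abs p (inverse (X m) - inverse (X n)) < e" if mn: "m \<ge> max K N" "n \<ge> max K N" for m n
  proof -
    have pos: "padic_abs p (X m) > L / 2" "padic_abs p (X n) > L / 2" using K mn by auto
    hence pos': "padic_abs p (X m) > 0" "padic_abs p (X n) > 0" using L by linarith+
    hence nz: "X m \<noteq> 0" "X n \<noteq> 0" using p by auto
    have "padic_abs p (inverse (X m) - inverse (X n)) =
            padic_abs p (inverse (X m) * (X n - X m) * inverse (X n))"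
      using nz by (intro arg_cong[where f = "padic_abs p"]) (simp add: field_simps)
    also have "\<dots> = padic_abs p (X m - X n) / (padic_abs p (X m) * padic_abs p (X n))"
      by (simp only: padic_abs_mult[OF p] padic_abs_inverse[OF p]
            padic_abs_diff_commute[OF p, of "X n"] divide_inverse inverse_mult_distrib mult_ac)
    also have "\<dots> < e"
    proof -
      have "padic_abs p (X m - X n) < e * (L / 2) * (L / 2)" using N mn by simp
      also have "\<dots> = e * ((L / 2) * (L / 2))" by simp
      also have "\<dots> \<le> e * (padic_abs p (X m) * padic_abs p (X n))"
        using pos e L by (intro mult_left_mono mult_mono) auto
      finally show ?thesis using pos' by (simp add: pos_divide_less_eq)
    qed
    finally show ?thesis .
  qed
  thus "\<exists>N. \<forall>m\<ge>N. \<forall>n\<ge>N. padic_abs p (inverse (X m) - inverse (X n)) < e" by blast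
qed

end

typedef ('p::prime_card) padic_seq = "{X. padic_cauchy CARD('p) X}"
  by (rule exI[of _ "\<lambda>_. 0"]) (simp add: padic_cauchy_const prime_card)

setup_lifting type_definition_padic_seq

instantiation padic_seq :: (prime_card) comm_ring_1
begin

lift_definition zero_padic_seq :: "'a padic_seq" is "\<lambda>_. 0"
  by (rule padic_cauchy_const[OF prime_card])

lift_definition one_padic_seq :: "'a padic_seq" is "\<lambda>_. 1"
  by (rule padic_cauchy_const[OF prime_card])

lift_definition plus_padic_seq :: "'a padic_seq \<Rightarrow> 'a padic_seq \<Rightarrow> 'a padic_seq" is "\<lambda>X Y n. X n + Y n"
  by (rule padic_cauchy_add[OF prime_card])

lift_definition uminus_padic_seq :: "'a padic_seq \<Rightarrow> 'a padic_seq" is "\<lambda>X n. - X n"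
  by (rule padic_cauchy_minus[OF prime_card])

lift_definition times_padic_seq :: "'a padic_seq \<Rightarrow> 'a padic_seq \<Rightarrow> 'a padic_seq" is "\<lambda>X Y n. X n * Y n"
  by (rule padic_cauchy_mult[OF prime_card])

lift_definition minus_padic_seq :: "'a padic_seq \<Rightarrow> 'a padic_seq \<Rightarrow> 'a padic_seq" is "\<lambda>X Y n. X n - Y n"
  by (rule padic_cauchy_diff[OF prime_card])

instance
proof
  fix X Y Z :: "'a padic_seq"
  show "X + Y + Z = X + (Y + Z)" by transfer (simp add: algebra_simps)
  show "X + Y = Y + X" by transfer (simp add: algebra_simps)
  show "0 + X = X" by transfer simp
  show "- X + X = 0" by transfer simp
  show "X - Y = X + - Y" by transfer simp
  show "X * Y * Z = X * (Y * Z)" by transfer (simp add: algebra_simps)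
  show "X * Y = Y * X" by transfer (simp add: algebra_simps)
  show "1 * X = X" by transfer simp
  show "(X + Y) * Z = X * Z + Y * Z" by transfer (simp add: algebra_simps)
  show "(0 :: 'a padic_seq) \<noteq> 1" by transfer (simp add: fun_eq_iff)
qed

end

lift_definition padic_seq_inverse :: "'p::prime_card padic_seq \<Rightarrow> 'p padic_seq" is
  "\<lambda>X. if lim (\<lambda>n. padic_abs CARD('p) (X n)) = 0 then (\<lambda>_. 0) else (\<lambda>n. inverse (X n))"
  by (auto intro: padic_cauchy_const padic_cauchy_inverse prime_card)

lift_definition padic_seq_norm :: "'p::prime_card padic_seq \<Rightarrow> real" is
  "\<lambda>X. lim (\<lambda>n. padic_abs CARD('p) (X n))" .

lift_definition padic_seq_const :: "rat \<Rightarrow> 'p::prime_card padic_seq" is "\<lambda>c _. c"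
  by (rule padic_cauchy_const[OF prime_card])

lemma padic_seq_norm_LIMSEQ:
  fixes X :: "'p::prime_card padic_seq"
  shows "(\<lambda>n. padic_abs CARD('p) (Rep_padic_seq X n)) \<longlonglongrightarrow> padic_seq_norm X"
  using padic_cauchy_convergent[OF prime_card[where 'a='p], of "Rep_padic_seq X"] Rep_padic_seq[of X]
  by (simp add: padic_seq_norm.rep_eq convergent_LIMSEQ_iff)

lemma padic_seq_norm_nonneg: "padic_seq_norm X \<ge> 0"
  by (rule LIMSEQ_le_const[OF padic_seq_norm_LIMSEQ]) (auto simp: padic_abs_nonneg[OF prime_card])

lemma padic_seq_norm_0: "padic_seq_norm 0 = 0"
  by transfer (simp add: padic_abs_0[OF prime_card])

lemma padic_seq_norm_mult: "padic_seq_norm (X * Y) = padic_seq_norm X * padic_seq_norm Y"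
  using LIMSEQ_unique[OF padic_seq_norm_LIMSEQ[of "X * Y"]]
    tendsto_mult[OF padic_seq_norm_LIMSEQ[of X] padic_seq_norm_LIMSEQ[of Y]]
  by (simp add: times_padic_seq.rep_eq padic_abs_mult[OF prime_card])

lemma padic_seq_norm_minus: "padic_seq_norm (- X) = padic_seq_norm X"
  using LIMSEQ_unique[OF padic_seq_norm_LIMSEQ[of "- X"]] padic_seq_norm_LIMSEQ[of X]
  by (simp add: uminus_padic_seq.rep_eq padic_abs_minus[OF prime_card])

lemma padic_seq_norm_add_le: "padic_seq_norm (X + Y) \<le> max (padic_seq_norm X) (padic_seq_norm Y)"
proof (rule LIMSEQ_le[OF padic_seq_norm_LIMSEQ])
  show "(\<lambda>n. max (padic_abs CARD('a) (Rep_padic_seq X n)) (padic_abs CARD('a) (Rep_padic_seq Y n)))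
          \<longlonglongrightarrow> max (padic_seq_norm X) (padic_seq_norm Y)"
    by (intro tendsto_max padic_seq_norm_LIMSEQ)
qed (auto simp: plus_padic_seq.rep_eq padic_abs_add_le[OF prime_card])

lemma padic_seq_norm_diff_commute: "padic_seq_norm (X - Y) = padic_seq_norm (Y - X)"
  using padic_seq_norm_minus[of "X - Y"] by simp

lemma padic_seq_norm_inverse:
  fixes X :: "'p::prime_card padic_seq"
  assumes "padic_seq_norm X \<noteq> 0"
  shows "padic_seq_norm (padic_seq_inverse X * X - 1) = 0"
proof -
  have lim: "(\<lambda>n. padic_abs CARD('p) (Rep_padic_seq X n)) \<longlonglongrightarrow> padic_seq_norm X"
    by (rule padic_seq_norm_LIMSEQ)
  have "eventually (\<lambda>n. padic_abs CARD('p) (Rep_padic_seq X n) \<noteq> 0) sequentially"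
    using tendsto_imp_eventually_ne[OF lim assms] .
  hence "eventually (\<lambda>n. padic_abs CARD('p) (Rep_padic_seq (padic_seq_inverse X * X - 1) n) = 0) sequentially"
  proof eventually_elim
    case (elim n)
    hence "Rep_padic_seq X n \<noteq> 0" by (auto simp: padic_abs_0[OF prime_card])
    thus ?case
      using assms
      by (simp add: minus_padic_seq.rep_eq times_padic_seq.rep_eq one_padic_seq.rep_eq padic_seq_inverse.rep_eq
          padic_seq_norm.rep_eq padic_abs_0[OF prime_card])
  qed
  hence "(\<lambda>n. padic_abs CARD('p) (Rep_padic_seq (padic_seq_inverse X * X - 1) n)) \<longlonglongrightarrow> 0"
    by (rule tendsto_eventually)
  thus ?thesis
    using LIMSEQ_unique[OF padic_seq_norm_LIMSEQ] by blast
qed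

lemma padic_seq_norm_const: "padic_seq_norm (padic_seq_const c :: 'p::prime_card padic_seq) = padic_abs CARD('p) c"
  by transfer simp

definition padic_rel :: "'p::prime_card padic_seq \<Rightarrow> 'p padic_seq \<Rightarrow> bool" where
  "padic_rel X Y \<longleftrightarrow> padic_seq_norm (X - Y) = 0"

lemma padic_rel_add_aux:
  assumes "padic_seq_norm X = 0" "padic_seq_norm Y = 0"
  shows "padic_seq_norm (X + Y) = 0"
  using assms padic_seq_norm_add_le[of X Y] padic_seq_norm_nonneg[of "X + Y"] by simp

lemma padic_rel_trans: "padic_rel X Y \<Longrightarrow> padic_rel Y Z \<Longrightarrow> padic_rel X Z"
  using padic_rel_add_aux[of "X - Y" "Y - Z"] by (simp add: padic_rel_def)

lemma padic_rel_sym: "padic_rel X Y \<Longrightarrow> padic_rel Y X"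
  by (simp add: padic_rel_def padic_seq_norm_diff_commute)

lemma equivp_padic_rel: "equivp padic_rel"
proof (intro equivpI reflpI sympI transpI)
  show "padic_rel X X" for X :: "'a padic_seq" by (simp add: padic_rel_def padic_seq_norm_0)
qed (fact padic_rel_sym padic_rel_trans)+

lemma padic_rel_add: "padic_rel X X' \<Longrightarrow> padic_rel Y Y' \<Longrightarrow> padic_rel (X + Y) (X' + Y')"
  using padic_rel_add_aux[of "X - X'" "Y - Y'"] by (simp add: padic_rel_def algebra_simps)

lemma padic_rel_uminus: "padic_rel X Y \<Longrightarrow> padic_rel (- X) (- Y)"
  using padic_seq_norm_minus[of "X - Y"] by (simp add: padic_rel_def)

lemma padic_rel_diff: "padic_rel X X' \<Longrightarrow> padic_rel Y Y' \<Longrightarrow> padic_rel (X - Y) (X' - Y')"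
  using padic_rel_add[of X X' "- Y" "- Y'"] padic_rel_uminus[of Y Y'] by simp

lemma padic_rel_mult:
  assumes "padic_rel X X'" "padic_rel Y Y'" shows "padic_rel (X * Y) (X' * Y')"
proof -
  have "padic_seq_norm (X * (Y - Y') + (X - X') * Y') = 0"
    using assms by (intro padic_rel_add_aux) (simp_all add: padic_rel_def padic_seq_norm_mult)
  thus ?thesis by (simp add: padic_rel_def algebra_simps)
qed

lemma padic_rel_norm:
  assumes "padic_rel X Y" shows "padic_seq_norm X = padic_seq_norm Y"
proof -
  have "padic_seq_norm (X - Y) = 0" "padic_seq_norm (Y - X) = 0"
    using assms by (simp_all add: padic_rel_def padic_seq_norm_diff_commute)
  thus ?thesis
    using padic_seq_norm_add_le[of "X - Y" Y] padic_seq_norm_add_le[of "Y - X" X]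
      padic_seq_norm_nonneg[of X] padic_seq_norm_nonneg[of Y]
    by simp
qed

lemma padic_rel_inverse:
  assumes "padic_rel X Y" shows "padic_rel (padic_seq_inverse X) (padic_seq_inverse Y)"
proof (cases "padic_seq_norm X = 0")
  case True
  have zero: "padic_seq_norm Z = 0 \<Longrightarrow> padic_seq_inverse Z = 0" for Z :: "'a padic_seq"
    by transfer simp
  have "padic_seq_inverse X = 0" "padic_seq_inverse Y = 0"
    using True padic_rel_norm[OF assms] by (auto intro!: zero)
  thus ?thesis by (simp add: padic_rel_def padic_seq_norm_0)
next
  case False
  define I J where "I = padic_seq_inverse X" and "J = padic_seq_inverse Y"
  have I: "padic_rel (I * X) 1" and J: "padic_rel (J * Y) 1"
    using padic_seq_norm_inverse[of X] padic_seq_norm_inverse[of Y] False padic_rel_norm[OF assms]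
    by (simp_all only: I_def J_def padic_rel_def) auto
  have refl: "padic_rel Z Z" for Z :: "'a padic_seq"
    by (simp add: padic_rel_def padic_seq_norm_0)
  have "padic_rel (I * 1) (I * (J * Y))" by (intro padic_rel_mult refl padic_rel_sym[OF J])
  moreover have "padic_rel (I * (J * Y)) (I * (J * X))"
    by (intro padic_rel_mult refl padic_rel_sym[OF assms])
  moreover have "padic_rel (J * (I * X)) (J * 1)" by (intro padic_rel_mult refl I)
  moreover have "J * (I * X) = I * (J * X)" by (simp only: mult_ac)
  ultimately have "padic_rel (I * 1) (J * 1)"
    using padic_rel_trans[of "I * 1" "I * (J * Y)" "I * (J * X)"]
      padic_rel_trans[of "I * 1" "I * (J * X)" "J * 1"] by simp
  thus ?thesis by (simp add: I_def J_def)
qed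

quotient_type 'p padic = "'p::prime_card padic_seq" / padic_rel
  by (rule equivp_padic_rel)

instantiation padic :: (prime_card) field
begin

lift_definition zero_padic :: "'a padic" is 0 .
lift_definition one_padic :: "'a padic" is 1 .
lift_definition plus_padic :: "'a padic \<Rightarrow> 'a padic \<Rightarrow> 'a padic" is "(+)" by (rule padic_rel_add)
lift_definition times_padic :: "'a padic \<Rightarrow> 'a padic \<Rightarrow> 'a padic" is "(*)" by (rule padic_rel_mult)
lift_definition uminus_padic :: "'a padic \<Rightarrow> 'a padic" is "uminus"
  by (rule padic_rel_uminus)
lift_definition inverse_padic :: "'a padic \<Rightarrow> 'a padic" is padic_seq_inverse by (rule padic_rel_inverse)

lift_definition minus_padic :: "'a padic \<Rightarrow> 'a padic \<Rightarrow> 'a padic" is "(-)" by (rule padic_rel_diff)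

definition divide_padic :: "'a padic \<Rightarrow> 'a padic \<Rightarrow> 'a padic" where
  "divide_padic x y = x * inverse y"

instance
proof
  fix x y z :: "'a padic"
  have eqI: "padic_rel X Y" if "X = Y" for X Y :: "'a padic_seq"
    using that by (simp add: padic_rel_def padic_seq_norm_0)
  show "x + y + z = x + (y + z)" by transfer (rule eqI, simp)
  show "x + y = y + x" by transfer (rule eqI, simp)
  show "0 + x = x" by transfer (rule eqI, simp)
  show "- x + x = 0" by transfer (rule eqI, simp)
  show "x - y = x + - y" by transfer (rule eqI, simp)
  show "x * y * z = x * (y * z)" by transfer (rule eqI, simp add: algebra_simps)
  show "x * y = y * x" by transfer (rule eqI, simp add: algebra_simps)
  show "1 * x = x" by transfer (rule eqI, simp)
  show "(x + y) * z = x * z + y * z" by transfer (rule eqI, simp add: algebra_simps)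
  show "(0 :: 'a padic) \<noteq> 1"
  proof (transfer, unfold padic_rel_def)
    have "(1 :: 'a padic_seq) = padic_seq_const 1" by transfer simp
    hence "padic_seq_norm (1 :: 'a padic_seq) = padic_abs CARD('a) 1"
      using padic_seq_norm_const[of 1, where 'p='a] by simp
    thus "padic_seq_norm (0 - 1 :: 'a padic_seq) \<noteq> 0"
      by (simp add: padic_seq_norm_minus padic_abs_1[OF prime_card])
  qed
  show "inverse x * x = 1" if "x \<noteq> 0"
    using that by transfer (simp add: padic_rel_def padic_seq_norm_inverse)
  show "x div y = x * inverse y" by (rule divide_padic_def)
  show "inverse (0 :: 'a padic) = 0"
  proof (transfer, rule eqI)
    show "padic_seq_inverse 0 = (0 :: 'a padic_seq)"
      by transfer (simp add: padic_abs_0[OF prime_card])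
  qed
qed

end

lift_definition padic_norm :: "'p::prime_card padic \<Rightarrow> real" ("\<bar>_\<bar>\<^sub>p") is padic_seq_norm
  by (rule padic_rel_norm)

lemma padic_norm_add_le_max: "\<bar>x + y\<bar>\<^sub>p \<le> max \<bar>x\<bar>\<^sub>p \<bar>y\<bar>\<^sub>p"
  by transfer (rule padic_seq_norm_add_le)

lemma padic_norm_nonneg [simp]: "\<bar>x\<bar>\<^sub>p \<ge> 0"
  by transfer (rule padic_seq_norm_nonneg)

lemma padic_norm_minus [simp]: "\<bar>- x\<bar>\<^sub>p = \<bar>x\<bar>\<^sub>p"
  by transfer (rule padic_seq_norm_minus)

lemma padic_norm_mult: "\<bar>x * y\<bar>\<^sub>p = \<bar>x\<bar>\<^sub>p * \<bar>y\<bar>\<^sub>p"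
  by transfer (rule padic_seq_norm_mult)

lemma padic_norm_eq_0_iff [simp]: "\<bar>x\<bar>\<^sub>p = 0 \<longleftrightarrow> x = 0"
  by transfer (simp add: padic_rel_def)

instantiation padic :: (prime_card) metric_space
begin

definition dist_padic :: "'a padic \<Rightarrow> 'a padic \<Rightarrow> real" where
  "dist_padic x y = \<bar>x - y\<bar>\<^sub>p"

definition uniformity_padic :: "('a padic \<times> 'a padic) filter" where
  "uniformity_padic = (INF e\<in>{0 <..}. principal {(x, y). dist x y < e})"

definition open_padic :: "'a padic set \<Rightarrow> bool" where
  "open_padic U \<longleftrightarrow> (\<forall>x\<in>U. \<forall>\<^sub>F (x', y) in uniformity. x' = x \<longrightarrow> y \<in> U)"

instance
proof
  fix x y z :: "'a padic"
  show "dist x y = 0 \<longleftrightarrow> x = y" by (simp add: dist_padic_def)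
  show "dist x y \<le> dist x z + dist y z"
    using padic_norm_add_le_max[of "x - z" "z - y"] padic_norm_nonneg[of "x - z"]
      padic_norm_nonneg[of "y - z"] padic_norm_minus[of "z - y"]
    by (simp add: dist_padic_def del: padic_norm_nonneg padic_norm_minus)
qed (simp_all add: uniformity_padic_def open_padic_def)

end

lemma of_nat_padic: "(of_nat n :: 'p::prime_card padic) = abs_padic (padic_seq_const (of_nat n))"
proof (induction n)
  case 0
  have "(0 :: 'p padic_seq) = padic_seq_const 0" by transfer simp
  thus ?case by (simp add: zero_padic.abs_eq)
next
  case (Suc n)
  have "(1 :: 'p padic_seq) + padic_seq_const (of_nat n) = padic_seq_const (of_nat (Suc n))"
    by transfer simp
  thus ?case by (simp add: Suc one_padic.abs_eq plus_padic.abs_eq)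
qed

instance padic :: (prime_card) field_char_0
proof
  have "False" if "m < n" "(of_nat m :: 'a padic) = of_nat n" for m n
  proof -
    have "(of_nat (n - m) :: 'a padic) = 0" using that by simp
    hence "\<bar>of_nat (n - m) :: 'a padic\<bar>\<^sub>p = 0" by simp
    hence "padic_abs CARD('a) (of_nat (n - m)) = 0"
      by (simp only: of_nat_padic padic_norm.abs_eq padic_seq_norm_const)
    thus False using that by (simp add: padic_abs_eq_0_iff[OF prime_card])
  qed
  thus "inj (of_nat :: nat \<Rightarrow> 'a padic)"
    by (intro injI) (metis linorder_neqE_nat)
qed

lemma of_rat_padic: "(of_rat q :: 'p::prime_card padic) = abs_padic (padic_seq_const q)"
proof -
  obtain a b where q: "b > 0" "q = of_int a / of_int b"
    by (metis quotient_of_denom_pos quotient_of_div surj_pair)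
  have minus: "abs_padic (padic_seq_const (- c)) = - (abs_padic (padic_seq_const c) :: 'p padic)" for c
  proof -
    have "- padic_seq_const c = (padic_seq_const (- c) :: 'p padic_seq)" by transfer simp
    thus ?thesis by (simp add: uminus_padic.abs_eq)
  qed
  have int: "of_int k = (abs_padic (padic_seq_const (of_int k)) :: 'p padic)" for k
    by (cases k rule: int_cases2) (simp_all add: of_nat_padic minus)
  have "padic_seq_const q * padic_seq_const (of_int b) = (padic_seq_const (of_int a) :: 'p padic_seq)"
    using q by (transfer fixing: q a b) simp
  hence "abs_padic (padic_seq_const q) * of_int b = (of_int a :: 'p padic)"
    by (simp add: int times_padic.abs_eq)
  moreover have "(of_int b :: 'p padic) \<noteq> 0" using q by simp
  ultimately show ?thesis by (simp add: q(2) of_rat_divide nonzero_divide_eq_eq)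
qed

theorem padic_norm_of_rat: "\<bar>of_rat q :: 'p::prime_card padic\<bar>\<^sub>p = padic_abs CARD('p) q"
  by (simp add: of_rat_padic padic_norm.abs_eq padic_seq_norm_const)

theorem rat_dense_padic:
  fixes x :: "'p::prime_card padic"
  assumes "e > 0"
  obtains q where "dist x (of_rat q) < e"
proof -
  have "\<exists>X. x = abs_padic X" by (induction x rule: padic.abs_induct) auto
  then obtain X where x: "x = abs_padic X" by blast
  have "padic_cauchy CARD('p) (Rep_padic_seq X)" using Rep_padic_seq[of X] by simp
  then obtain N where N: "\<And>m n. m \<ge> N \<Longrightarrow> n \<ge> N \<Longrightarrow>
      padic_abs CARD('p) (Rep_padic_seq X m - Rep_padic_seq X n) < e / 2"
    using padic_cauchyD[of _ _ "e / 2"] assms by (metis half_gt_zero)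
  let ?q = "Rep_padic_seq X N"
  have "dist x (of_rat ?q) = padic_seq_norm (X - padic_seq_const ?q)"
    by (simp add: dist_padic_def x of_rat_padic minus_padic.abs_eq padic_norm.abs_eq)
  also have "\<dots> \<le> e / 2"
  proof (rule LIMSEQ_le_const2[OF padic_seq_norm_LIMSEQ])
    show "\<exists>M. \<forall>n\<ge>M. padic_abs CARD('p) (Rep_padic_seq (X - padic_seq_const ?q) n) \<le> e / 2"
      using N by (intro exI[of _ N])
        (auto simp: minus_padic_seq.rep_eq padic_seq_const.rep_eq intro: less_imp_le)
  qed
  also have "\<dots> < e" using assms by simp
  finally show ?thesis by (rule that)
qed

instance padic :: (prime_card) complete_space
proof
  fix x :: "nat \<Rightarrow> 'a padic"
  assume x: "Cauchy x"
  have "\<exists>q. dist (x n) (of_rat q) < inverse (real (Suc n))" for n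
    using rat_dense_padic[of "inverse (real (Suc n))" "x n"] by auto
  then obtain q where q: "\<And>n. dist (x n) (of_rat (q n)) < inverse (real (Suc n))" by metis
  have small: "\<exists>N. \<forall>n\<ge>N. dist (x n) (of_rat (q n)) < e" if "e > 0" for e
  proof -
    obtain N where N: "inverse (real (Suc N)) < e" using reals_Archimedean[of e] \<open>e > 0\<close> by auto
    have "dist (x n) (of_rat (q n)) < e" if "n \<ge> N" for n
    proof -
      have "inverse (real (Suc n)) \<le> inverse (real (Suc N))" using that by simp
      thus ?thesis using q[of n] N by linarith
    qed
    thus ?thesis by blast
  qed
  have dist_q: "dist (of_rat a :: 'a padic) (of_rat b) = padic_abs CARD('a) (a - b)" for a b
    by (simp only: dist_padic_def padic_norm_of_rat of_rat_diff[symmetric])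
  have cauchy: "padic_cauchy CARD('a) q"
    unfolding padic_cauchy_def
  proof (intro allI impI)
    fix e :: real assume e: "e > 0"
    obtain M where M: "\<And>m n. m \<ge> M \<Longrightarrow> n \<ge> M \<Longrightarrow> dist (x m) (x n) < e / 3"
      using x e unfolding Cauchy_def by (metis divide_pos_pos zero_less_numeral)
    obtain N where N: "\<And>n. n \<ge> N \<Longrightarrow> dist (x n) (of_rat (q n)) < e / 3"
      using small[of "e / 3"] e by auto
    have "padic_abs CARD('a) (q m - q n) < e" if "m \<ge> max M N" "n \<ge> max M N" for m n
      using M[of m n] N[of m] N[of n] that dist_q[of "q m" "q n"]
        dist_triangle[of "of_rat (q m)" "of_rat (q n)" "x m"]
        dist_triangle[of "x m" "of_rat (q n)" "x n"]
      by (simp add: dist_commute)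
    thus "\<exists>N. \<forall>m\<ge>N. \<forall>n\<ge>N. padic_abs CARD('a) (q m - q n) < e" by blast
  qed
  define Y where "Y = (Abs_padic_seq q :: 'a padic_seq)"
  have Y: "Rep_padic_seq Y = q" using cauchy by (simp add: Y_def Abs_padic_seq_inverse)
  have "x \<longlonglongrightarrow> abs_padic Y"
  proof (rule metric_LIMSEQ_I)
    fix e :: real assume e: "e > 0"
    obtain N where N: "\<And>m n. m \<ge> N \<Longrightarrow> n \<ge> N \<Longrightarrow> padic_abs CARD('a) (q m - q n) < e / 2"
      using padic_cauchyD[OF cauchy, of "e / 2"] e by auto
    obtain M where M: "\<And>n. n \<ge> M \<Longrightarrow> dist (x n) (of_rat (q n)) < e / 2"
      using small[of "e / 2"] e by auto
    have "dist (x n) (abs_padic Y) < e" if n: "n \<ge> max M N" for n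
    proof -
      have "dist (abs_padic Y) (of_rat (q n)) = padic_seq_norm (Y - padic_seq_const (q n))"
        by (simp add: dist_padic_def of_rat_padic minus_padic.abs_eq padic_norm.abs_eq)
      also have "\<dots> \<le> e / 2"
      proof (rule LIMSEQ_le_const2[OF padic_seq_norm_LIMSEQ])
        show "\<exists>M. \<forall>k\<ge>M. padic_abs CARD('a) (Rep_padic_seq (Y - padic_seq_const (q n)) k) \<le> e / 2"
          using N n by (intro exI[of _ N])
            (auto simp: minus_padic_seq.rep_eq padic_seq_const.rep_eq Y intro: less_imp_le)
      qed
      finally show ?thesis
        using M[of n] n dist_triangle[of "x n" "abs_padic Y" "of_rat (q n)"]
        by (simp add: dist_commute)
    qed
    thus "\<exists>N. \<forall>n\<ge>N. dist (x n) (abs_padic Y) < e" by blast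
  qed
  thus "convergent x" by (auto simp: convergent_def)
qed

lemma padic_norm_eq_dist: "\<bar>x\<bar>\<^sub>p = dist x (0 :: 'p::prime_card padic)"
  by (simp add: dist_padic_def)

lemma padic_norm_triangle: "\<bar>x + y\<bar>\<^sub>p \<le> \<bar>x\<bar>\<^sub>p + \<bar>y\<bar>\<^sub>p"
  using padic_norm_add_le_max[of x y] padic_norm_nonneg[of x] padic_norm_nonneg[of y] by linarith

lemma padic_norm_1 [simp]: "\<bar>1 :: 'p::prime_card padic\<bar>\<^sub>p = 1"
  using padic_norm_of_rat[of 1, where 'p='p] by (simp add: padic_abs_1[OF prime_card])

lemma padic_norm_inverse: "\<bar>inverse x\<bar>\<^sub>p = inverse \<bar>x :: 'p::prime_card padic\<bar>\<^sub>p"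
proof (cases "x = 0")
  case False
  have "\<bar>x\<bar>\<^sub>p * \<bar>inverse x\<bar>\<^sub>p = 1" using False by (simp flip: padic_norm_mult)
  thus ?thesis by (simp add: inverse_unique)
qed (simp add: padic_norm_eq_dist)

lemma tendsto_padicI:
  fixes f :: "'a \<Rightarrow> 'p::prime_card padic"
  assumes "(g \<longlongrightarrow> 0) F" "eventually (\<lambda>x. \<bar>f x - L\<bar>\<^sub>p \<le> g x) F"
  shows "(f \<longlongrightarrow> L) F"
proof -
  have "((\<lambda>x. dist (f x) L) \<longlongrightarrow> 0) F"
    by (rule tendsto_sandwich[OF _ _ tendsto_const assms(1)])
       (use assms(2) in \<open>simp_all add: dist_padic_def\<close>)
  thus ?thesis by (rule iffD2[OF tendsto_dist_iff])
qed

lemma tendsto_padic_norm_diff: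
  fixes f :: "'a \<Rightarrow> 'p::prime_card padic"
  assumes "(f \<longlongrightarrow> L) F" shows "((\<lambda>x. \<bar>f x - L\<bar>\<^sub>p) \<longlongrightarrow> 0) F"
  using iffD1[OF tendsto_dist_iff assms] by (simp add: dist_padic_def)

lemma tendsto_padic_norm:
  fixes f :: "'a \<Rightarrow> 'p::prime_card padic"
  assumes "(f \<longlongrightarrow> L) F" shows "((\<lambda>x. \<bar>f x\<bar>\<^sub>p) \<longlongrightarrow> \<bar>L\<bar>\<^sub>p) F"
  unfolding padic_norm_eq_dist by (intro tendsto_intros assms)

instance padic :: (prime_card) topological_ab_group_add
proof
  fix a b :: "'a padic"
  have a: "(fst \<longlongrightarrow> a) (nhds a \<times>\<^sub>F nhds b)" and b: "(snd \<longlongrightarrow> b) (nhds a \<times>\<^sub>F nhds b)"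
    by (rule filterlim_fst filterlim_snd)+
  show "((\<lambda>x. fst x + snd x) \<longlongrightarrow> a + b) (nhds a \<times>\<^sub>F nhds b)"
  proof (rule tendsto_padicI)
    show "((\<lambda>x. \<bar>fst x - a\<bar>\<^sub>p + \<bar>snd x - b\<bar>\<^sub>p) \<longlongrightarrow> 0) (nhds a \<times>\<^sub>F nhds b)"
      using tendsto_add[OF tendsto_padic_norm_diff[OF a] tendsto_padic_norm_diff[OF b]] by simp
    have "\<bar>fst x + snd x - (a + b)\<bar>\<^sub>p \<le> \<bar>fst x - a\<bar>\<^sub>p + \<bar>snd x - b\<bar>\<^sub>p" for x
      using padic_norm_triangle[of "fst x - a" "snd x - b"] by (simp add: algebra_simps)
    thus "\<forall>\<^sub>F x in nhds a \<times>\<^sub>F nhds b. \<bar>fst x + snd x - (a + b)\<bar>\<^sub>p \<le> \<bar>fst x - a\<bar>\<^sub>p + \<bar>snd x - b\<bar>\<^sub>p"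
      by simp
  qed
  have id: "((\<lambda>x. x) \<longlongrightarrow> a) (nhds a)" by (rule filterlim_ident)
  show "(uminus \<longlongrightarrow> - a) (nhds a)"
  proof (rule tendsto_padicI[OF tendsto_padic_norm_diff[OF id]])
    have "\<bar>- x - - a\<bar>\<^sub>p = \<bar>x - a\<bar>\<^sub>p" for x
      using padic_norm_minus[of "x - a"] by (simp add: algebra_simps)
    thus "\<forall>\<^sub>F x in nhds a. \<bar>- x - - a\<bar>\<^sub>p \<le> \<bar>x - a\<bar>\<^sub>p" by simp
  qed
qed

instance padic :: (prime_card) topological_semigroup_mult
proof
  fix a b :: "'a padic"
  have a: "(fst \<longlongrightarrow> a) (nhds a \<times>\<^sub>F nhds b)" and b: "(snd \<longlongrightarrow> b) (nhds a \<times>\<^sub>F nhds b)"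
    by (rule filterlim_fst filterlim_snd)+
  show "((\<lambda>x. fst x * snd x) \<longlongrightarrow> a * b) (nhds a \<times>\<^sub>F nhds b)"
  proof (rule tendsto_padicI)
    show "((\<lambda>x. \<bar>fst x\<bar>\<^sub>p * \<bar>snd x - b\<bar>\<^sub>p + \<bar>fst x - a\<bar>\<^sub>p * \<bar>b\<bar>\<^sub>p) \<longlongrightarrow> 0) (nhds a \<times>\<^sub>F nhds b)"
      using tendsto_add[OF tendsto_mult[OF tendsto_padic_norm[OF a] tendsto_padic_norm_diff[OF b]]
          tendsto_mult_right[OF tendsto_padic_norm_diff[OF a], of "\<bar>b\<bar>\<^sub>p"]] by simp
    have "\<bar>fst x * snd x - a * b\<bar>\<^sub>p \<le> \<bar>fst x\<bar>\<^sub>p * \<bar>snd x - b\<bar>\<^sub>p + \<bar>fst x - a\<bar>\<^sub>p * \<bar>b\<bar>\<^sub>p" for x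
      using padic_norm_triangle[of "fst x * (snd x - b)" "(fst x - a) * b"]
      by (simp add: algebra_simps flip: padic_norm_mult)
    thus "\<forall>\<^sub>F x in nhds a \<times>\<^sub>F nhds b.
        \<bar>fst x * snd x - a * b\<bar>\<^sub>p \<le> \<bar>fst x\<bar>\<^sub>p * \<bar>snd x - b\<bar>\<^sub>p + \<bar>fst x - a\<bar>\<^sub>p * \<bar>b\<bar>\<^sub>p"
      by simp
  qed
qed

lemma tendsto_inverse_padic:
  fixes f :: "'a \<Rightarrow> 'p::prime_card padic"
  assumes f: "(f \<longlongrightarrow> L) F" and L: "L \<noteq> 0"
  shows "((\<lambda>x. inverse (f x)) \<longlongrightarrow> inverse L) F"
proof (rule tendsto_padicI)
  have "((\<lambda>x. \<bar>f x - L\<bar>\<^sub>p / (\<bar>f x\<bar>\<^sub>p * \<bar>L\<bar>\<^sub>p)) \<longlongrightarrow> 0 / (\<bar>L\<bar>\<^sub>p * \<bar>L\<bar>\<^sub>p)) F"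
    using L by (intro tendsto_intros tendsto_padic_norm_diff tendsto_padic_norm f) simp
  thus "((\<lambda>x. \<bar>f x - L\<bar>\<^sub>p / (\<bar>f x\<bar>\<^sub>p * \<bar>L\<bar>\<^sub>p)) \<longlongrightarrow> 0) F" by simp
  show "\<forall>\<^sub>F x in F. \<bar>inverse (f x) - inverse L\<bar>\<^sub>p \<le> \<bar>f x - L\<bar>\<^sub>p / (\<bar>f x\<bar>\<^sub>p * \<bar>L\<bar>\<^sub>p)"
    using tendsto_imp_eventually_ne[OF f L]
  proof eventually_elim
    case (elim x)
    have "inverse (f x) - inverse L = (- (f x - L)) * (inverse (f x) * inverse L)"
      using elim L by (simp add: field_simps)
    hence "\<bar>inverse (f x) - inverse L\<bar>\<^sub>p = \<bar>f x - L\<bar>\<^sub>p * (inverse \<bar>f x\<bar>\<^sub>p * inverse \<bar>L\<bar>\<^sub>p)"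
      by (simp only: padic_norm_mult padic_norm_minus padic_norm_inverse)
    thus ?case by (simp add: divide_inverse)
  qed
qed

lemma tendsto_poly_padic:
  fixes F :: "'p::prime_card padic poly"
  shows "((\<lambda>x. poly F x) \<longlongrightarrow> poly F a) (at a)"
  by (induction F) (auto intro!: tendsto_add tendsto_mult tendsto_const)


section \<open>Haar measure and measure-preserving maps\<close>

definition is_haar_measure :: "'p::prime_card padic measure \<Rightarrow> bool" where
  "is_haar_measure \<mu> \<longleftrightarrow>
     sets \<mu> = sets borel \<and>
     (\<forall>c. \<forall>A\<in>sets borel. emeasure \<mu> ((\<lambda>x. c + x) ` A) = emeasure \<mu> A) \<and>
     (\<forall>c k. emeasure \<mu> (cball c (real CARD('p) powi k)) = ennreal (real CARD('p) powi k))"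

definition measure_preserving_on :: "'a::topological_space measure \<Rightarrow> 'a set \<Rightarrow> ('a \<Rightarrow> 'a) \<Rightarrow> bool" where
  "measure_preserving_on \<mu> Y g \<longleftrightarrow>
     g ` Y \<subseteq> Y \<and>
     (\<forall>A\<in>sets borel. A \<subseteq> Y \<longrightarrow>
        g -` A \<inter> Y \<in> sets borel \<and> emeasure \<mu> (g -` A \<inter> Y) = emeasure \<mu> A)"


section \<open>Rational functions over \<open>\<int>\<^sub>p\<close>\<close>

definition Zp_poly :: "'p::prime_card padic poly set" where
  "Zp_poly = {F. \<forall>i. \<bar>coeff F i\<bar>\<^sub>p \<le> 1}"

text \<open>
  Coprimality in the ring \<open>\<int>\<^sub>p[x]\<close>: every common divisor in \<open>\<int>\<^sub>p[x]\<close> is a unit of \<open>\<int>\<^sub>p[x]\<close>.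
  This is stronger than \<^const>\<open>coprime\<close> over the field, as it also excludes the common factor \<open>p\<close>.
\<close>

definition Zp_coprime :: "'p::prime_card padic poly \<Rightarrow> 'p padic poly \<Rightarrow> bool" where
  "Zp_coprime P Q \<longleftrightarrow>
     (\<forall>D\<in>Zp_poly. (\<exists>A\<in>Zp_poly. P = D * A) \<and> (\<exists>B\<in>Zp_poly. Q = D * B)
        \<longrightarrow> (\<exists>E\<in>Zp_poly. D * E = 1))"

definition rat_fun :: "'p::prime_card padic poly \<Rightarrow> 'p padic poly \<Rightarrow> 'p padic \<Rightarrow> 'p padic" where
  "rat_fun P Q x = poly P x / poly Q x"

definition rat_fun_deriv :: "'p::prime_card padic poly \<Rightarrow> 'p padic poly \<Rightarrow> 'p padic \<Rightarrow> 'p padic" where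
  "rat_fun_deriv P Q x =
     (poly (pderiv P) x * poly Q x - poly P x * poly (pderiv Q) x) / (poly Q x)\<^sup>2"

lemma rat_fun_deriv_limit:
  fixes P Q :: "'p::prime_card padic poly"
  assumes Qa: "poly Q a \<noteq> 0"
  shows "((\<lambda>x. (rat_fun P Q x - rat_fun P Q a) / (x - a)) \<longlongrightarrow> rat_fun_deriv P Q a) (at a)"
proof -
  have synth: "\<exists>G. (\<forall>x. poly F x = poly F a + (x - a) * poly G x) \<and> poly G a = poly (pderiv F) a"
    for F :: "'p padic poly"
  proof -
    have "[:- a, 1:] dvd F - [:poly F a:]" by (simp flip: poly_eq_0_iff_dvd)
    then obtain G where "F - [:poly F a:] = [:- a, 1:] * G" by (elim dvdE)
    hence F: "F = [:- a, 1:] * G + [:poly F a:]" unfolding diff_eq_eq .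
    show ?thesis
    proof (intro exI conjI allI)
      show "poly F x = poly F a + (x - a) * poly G x" for x
        by (subst F) (simp add: algebra_simps)
      show "poly G a = poly (pderiv F) a"
        by (subst F) (simp add: pderiv_add pderiv_diff pderiv_smult pderiv_pCons)
    qed
  qed
  obtain A where A: "\<And>x. poly P x = poly P a + (x - a) * poly A x" "poly A a = poly (pderiv P) a"
    using synth[of P] by blast
  obtain B where B: "\<And>x. poly Q x = poly Q a + (x - a) * poly B x" "poly B a = poly (pderiv Q) a"
    using synth[of Q] by blast
  let ?h = "\<lambda>x. (poly A x * poly Q a - poly P a * poly B x) * inverse (poly Q x * poly Q a)"
  have "(?h \<longlongrightarrow> (poly A a * poly Q a - poly P a * poly B a) * inverse (poly Q a * poly Q a)) (at a)"
    using Qa by (intro tendsto_mult tendsto_diff tendsto_inverse_padic tendsto_poly_padic tendsto_const) auto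
  also have "(poly A a * poly Q a - poly P a * poly B a) * inverse (poly Q a * poly Q a) = rat_fun_deriv P Q a"
    by (simp add: rat_fun_deriv_def A(2) B(2) divide_inverse power2_eq_square)
  finally have lim: "(?h \<longlongrightarrow> rat_fun_deriv P Q a) (at a)" .
  have "eventually (\<lambda>x. x \<noteq> a) (at a)" by (simp add: eventually_at_filter)
  moreover have "eventually (\<lambda>x. poly Q x \<noteq> 0) (at a)"
    using tendsto_imp_eventually_ne[OF tendsto_poly_padic Qa] .
  ultimately have "eventually (\<lambda>x. ?h x = (rat_fun P Q x - rat_fun P Q a) / (x - a)) (at a)"
  proof eventually_elim
    case (elim x)
    have "poly P x * poly Q a - poly P a * poly Q x =
            (x - a) * (poly A x * poly Q a - poly P a * poly B x)"
      by (simp only: A(1)[of x] B(1)[of x]) (simp add: algebra_simps)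
    moreover have "rat_fun P Q x - rat_fun P Q a =
        (poly P x * poly Q a - poly P a * poly Q x) * inverse (poly Q x * poly Q a)"
      using elim Qa by (simp add: rat_fun_def field_simps)
    ultimately have "rat_fun P Q x - rat_fun P Q a = (x - a) * ?h x"
      by (simp only: mult.assoc)
    thus ?case using elim by simp
  qed
  with lim show ?thesis by (rule Lim_transform_eventually)
qed

definition rational_self_map ::
  "'p::prime_card padic poly \<Rightarrow> 'p padic poly \<Rightarrow> 'p padic set \<Rightarrow> bool" where
  "rational_self_map P Q X \<longleftrightarrow>
     P \<in> Zp_poly \<and> Q \<in> Zp_poly \<and> Zp_coprime P Q \<and> Q \<noteq> 0 \<and>
     (\<forall>x\<in>X. poly Q x \<noteq> 0) \<and> rat_fun P Q ` X \<subseteq> X"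

definition locally_1_lipschitz :: "'p::prime_card padic set \<Rightarrow> ('p padic \<Rightarrow> 'p padic) \<Rightarrow> bool" where
  "locally_1_lipschitz X g \<longleftrightarrow>
     (\<forall>a\<in>X. \<exists>r>0. \<forall>x\<in>cball a r \<inter> X. \<forall>y\<in>cball a r \<inter> X. \<bar>g x - g y\<bar>\<^sub>p \<le> \<bar>x - y\<bar>\<^sub>p)"

definition admissible ::
  "'p::prime_card padic poly \<Rightarrow> 'p padic poly \<Rightarrow> 'p padic set \<Rightarrow> int \<Rightarrow> bool" where
  "admissible P Q X l \<longleftrightarrow>
     (\<forall>a\<in>X. cball a (real CARD('p) powi l) \<subseteq> X \<and>
        (\<forall>x\<in>cball a (real CARD('p) powi l). \<forall>y\<in>cball a (real CARD('p) powi l).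
           \<bar>rat_fun P Q x - rat_fun P Q y\<bar>\<^sub>p = \<bar>rat_fun_deriv P Q a\<bar>\<^sub>p * \<bar>x - y\<bar>\<^sub>p))"


section \<open>The digraphs of balls\<close>

text \<open>
  The vertices \<open>A\<^bsub>t,i\<^esub>\<close> are identified with the balls \<open>D\<^bsub>t,i\<^esub>\<close>. Two balls of the same radius
  are equal or disjoint, so the decomposition of \<open>X\<close> into balls of radius \<open>p\<^sup>t\<close> consists of all
  such balls contained in \<open>X\<close>; see \<open>partition_on_balls\<close> and \<open>balls_unique\<close> below.
\<close>

definition balls :: "'p::prime_card padic set \<Rightarrow> int \<Rightarrow> 'p padic set set" where
  "balls X t = {D. D \<subseteq> X \<and> (\<exists>a. D = cball a (real CARD('p) powi t))}"

lemma real_CARD_powi_pos [simp]: "real CARD('p::prime_card) powi t > 0"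
  using prime_gt_0_nat[OF prime_card[where 'a='p]] by (intro zero_less_power_int) simp

lemma real_CARD_powi_nonneg [simp]: "real CARD('p::prime_card) powi t \<ge> 0"
  by (rule less_imp_le[OF real_CARD_powi_pos])

lemma real_CARD_powi_not_neg [simp]: "\<not> real CARD('p::prime_card) powi t < 0"
  by (simp add: not_less)

lemma dist_padic_ultrametric: "dist x z \<le> max (dist x y) (dist y (z :: 'p::prime_card padic))"
  using padic_norm_add_le_max[of "x - y" "y - z"] by (simp add: dist_padic_def)

lemma cball_padic_eq:
  fixes a b :: "'p::prime_card padic"
  assumes "b \<in> cball a r"
  shows "cball b r = cball a r"
proof -
  have "dist b x \<le> r \<longleftrightarrow> dist a x \<le> r" for x
    using assms dist_padic_ultrametric[of b x a] dist_padic_ultrametric[of a x b]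
    by (auto simp: dist_commute)
  thus ?thesis by auto
qed

lemma open_cball_padic:
  fixes a :: "'p::prime_card padic"
  assumes "r > 0"
  shows "open (cball a r)"
  unfolding open_contains_cball
proof
  fix x assume "x \<in> cball a r"
  hence "cball x r \<subseteq> cball a r" by (simp only: cball_padic_eq)
  thus "\<exists>e>0. cball x e \<subseteq> cball a r" using assms by blast
qed

lemma partition_on_balls:
  fixes X :: "'p::prime_card padic set"
  assumes "admissible P Q X l" "t \<le> l"
  shows "partition_on X (balls X t)"
proof (rule partition_onI)
  show "\<Union>(balls X t) = X"
  proof (intro equalityI subsetI)
    fix x assume x: "x \<in> X"
    have "real CARD('p) powi t \<le> real CARD('p) powi l"
      using assms(2) prime_gt_1_nat[OF prime_card[where 'a='p]] by (intro power_int_increasing) auto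
    moreover have "cball x (real CARD('p) powi l) \<subseteq> X" using assms(1) x by (simp add: admissible_def)
    ultimately have "cball x (real CARD('p) powi t) \<subseteq> X" by auto
    hence "cball x (real CARD('p) powi t) \<in> balls X t" by (auto simp: balls_def)
    moreover have "x \<in> cball x (real CARD('p) powi t)" by simp
    ultimately show "x \<in> \<Union>(balls X t)" by blast
  qed (auto simp: balls_def)
next
  fix D E assume "D \<in> balls X t" "E \<in> balls X t" "D \<noteq> E"
  then obtain a b where ab: "D = cball a (real CARD('p) powi t)" "E = cball b (real CARD('p) powi t)" "D \<noteq> E"
    by (auto simp: balls_def)
  have "x \<notin> E" if "x \<in> D" for x
    using ab that cball_padic_eq[of x a "real CARD('p) powi t"] cball_padic_eq[of x b "real CARD('p) powi t"]
    by metis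
  thus "disjnt D E" by (auto simp: disjnt_def)
next
  show "{} \<notin> balls X t"
  proof
    assume "{} \<in> balls X t"
    then obtain a :: "'p padic" where "{} = cball a (real CARD('p) powi t)" by (auto simp: balls_def)
    moreover have "a \<in> cball a (real CARD('p) powi t)" by simp
    ultimately show False by blast
  qed
qed

lemma balls_unique:
  fixes X :: "'p::prime_card padic set"
  assumes "partition_on X \<D>" "\<forall>D\<in>\<D>. \<exists>a. D = cball a (real CARD('p) powi t)"
  shows "\<D> = balls X t"
proof
  show "\<D> \<subseteq> balls X t" using assms by (auto simp: balls_def partition_on_def)
  show "balls X t \<subseteq> \<D>"
  proof
    fix E assume "E \<in> balls X t"
    then obtain b where E: "E \<subseteq> X" "E = cball b (real CARD('p) powi t)" by (auto simp: balls_def)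
    have b: "b \<in> E" by (simp add: E(2))
    then obtain D where D: "D \<in> \<D>" "b \<in> D" using E(1) assms(1) by (auto simp: partition_on_def)
    then obtain a where "D = cball a (real CARD('p) powi t)" using assms(2) by blast
    hence "D = E" using cball_padic_eq[of b a] D(2) E(2) by simp
    thus "E \<in> \<D>" using D by simp
  qed
qed

lemma finite_balls:
  fixes X :: "'p::prime_card padic set"
  assumes "compact X" "admissible P Q X l" "t \<le> l"
  shows "finite (balls X t)"
proof -
  have part: "partition_on X (balls X t)" by (rule partition_on_balls[OF assms(2,3)])
  have "open D" if "D \<in> balls X t" for D
    using that by (auto simp: balls_def intro!: open_cball_padic)
  then obtain F where F: "F \<subseteq> balls X t" "finite F" "X \<subseteq> \<Union>F"
    using compactE[OF assms(1), of "balls X t"] part by (auto simp: partition_on_def)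
  have "balls X t \<subseteq> F"
  proof
    fix D assume D: "D \<in> balls X t"
    hence "D \<noteq> {}" using part by (auto simp: partition_on_def)
    then obtain x where x: "x \<in> D" by blast
    hence "x \<in> X" using D by (auto simp: balls_def)
    then obtain E where E: "E \<in> F" "x \<in> E" using F by blast
    hence "E \<in> balls X t" "D \<inter> E \<noteq> {}" using F(1) x by auto
    hence "D = E" using part D by (metis disjointD partition_onD2)
    thus "D \<in> F" using E by simp
  qed
  thus ?thesis using F(2) finite_subset by blast
qed

definition ball_digraph ::
  "'p::prime_card padic poly \<Rightarrow> 'p padic poly \<Rightarrow> 'p padic set \<Rightarrow> int \<Rightarrow> 'p padic set pair_pre_digraph"
  where
  "ball_digraph P Q X t =
     \<lparr>pverts = balls X t,
      parcs = {(D, E). D \<in> balls X t \<and> E \<in> balls X t \<and> rat_fun P Q ` D \<subseteq> E}\<rparr>"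

text \<open>\<open>a t D\<close> is the representative \<open>a\<^bsub>t,i\<^esub>\<close> of \<open>D = D\<^bsub>t,i\<^esub>\<close>, and \<open>S\<^sub>t\<close> is \<open>a t ` balls X t\<close>.\<close>

definition is_representatives ::
  "'p::prime_card padic set \<Rightarrow> int \<Rightarrow> (int \<Rightarrow> 'p padic set \<Rightarrow> 'p padic) \<Rightarrow> bool" where
  "is_representatives X l a \<longleftrightarrow>
     (\<forall>t\<le>l. \<forall>D\<in>balls X t. a t D \<in> D) \<and>
     (\<forall>t\<le>l. a t ` balls X t \<subseteq> a (t - 1) ` balls X (t - 1))"

text \<open>
  \<open>P(p\<^sup>s x + c) - (p\<^sup>s y + d) Q(p\<^sup>s x + c)\<close> as an element of \<open>\<rat>\<^sub>p[x][y]\<close>: the inner polynomial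
  variable is \<open>x\<close>, the outer one is \<open>y\<close>.
\<close>

definition edge_poly ::
  "'p::prime_card padic poly \<Rightarrow> 'p padic poly \<Rightarrow> 'p padic \<Rightarrow> 'p padic \<Rightarrow> nat \<Rightarrow> 'p padic poly poly" where
  "edge_poly P Q c d s =
     (let u = [:c, of_nat CARD('p) ^ s:];
          v = [:[:d:], [:of_nat CARD('p) ^ s:]:]
      in [:P \<circ>\<^sub>p u:] - v * [:Q \<circ>\<^sub>p u:])"

definition edge_poly_integral ::
  "'p::prime_card padic poly \<Rightarrow> 'p padic poly \<Rightarrow> 'p padic \<Rightarrow> 'p padic \<Rightarrow> nat \<Rightarrow> bool" where
  "edge_poly_integral P Q c d s \<longleftrightarrow> (\<forall>i j. \<bar>coeff (coeff (edge_poly P Q c d s) i) j\<bar>\<^sub>p \<le> 1)"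

definition subsidiary_cond ::
  "'p::prime_card padic poly \<Rightarrow> 'p padic poly \<Rightarrow> int \<Rightarrow> int \<Rightarrow> 'p padic \<Rightarrow> 'p padic \<Rightarrow> bool" where
  "subsidiary_cond P Q l t c d \<longleftrightarrow>
     (\<exists>s. edge_poly_integral P Q c d s) \<and>
     (let p = real CARD('p);
          s = int (LEAST s. edge_poly_integral P Q c d s);
          absf' = \<bar>rat_fun_deriv P Q c\<bar>\<^sub>p;
          absQ = \<bar>poly Q c\<bar>\<^sub>p;
          absQ' = \<bar>poly (pderiv Q) c\<bar>\<^sub>p
      in ereal (p powi t) <
           Min {ereal (p powi (- s)),
                ereal (p powi l * absf'),
                (if poly (pderiv Q) c = 0 then \<infinity> else ereal (absQ * absf' / absQ')),
                ereal (p powi (- 2 * s) * absQ * absf'\<^sup>2)})"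

definition subsidiary_digraph ::
  "'p::prime_card padic poly \<Rightarrow> 'p padic poly \<Rightarrow> 'p padic set \<Rightarrow> int \<Rightarrow>
     (int \<Rightarrow> 'p padic set \<Rightarrow> 'p padic) \<Rightarrow> int \<Rightarrow> 'p padic set pair_pre_digraph" where
  "subsidiary_digraph P Q X l a t =
     \<lparr>pverts = balls X t,
      parcs = {(D, E). D \<in> balls X t \<and> E \<in> balls X t \<and> rat_fun P Q ` D \<subseteq> E \<and>
                 subsidiary_cond P Q l t (a t D) (a t E)}\<rparr>"

definition is_intrinsic_level ::
  "'p::prime_card padic poly \<Rightarrow> 'p padic poly \<Rightarrow> 'p padic set \<Rightarrow> int \<Rightarrow>
     (int \<Rightarrow> 'p padic set \<Rightarrow> 'p padic) \<Rightarrow> int \<Rightarrow> bool" where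
  "is_intrinsic_level P Q X l a t0 \<longleftrightarrow>
     t0 \<le> l \<and> ball_digraph P Q X t0 = subsidiary_digraph P Q X l a t0 \<and>
     (\<forall>t\<le>l. ball_digraph P Q X t = subsidiary_digraph P Q X l a t \<longrightarrow> t \<le> t0)"

text \<open>
  A cycle is given by its list of arcs, as in \<open>pre_digraph.cycle\<close>, which counts loops as cycles.
  The collection of cycles may be empty.
\<close>

definition is_union_of_cycles :: "'a pair_pre_digraph \<Rightarrow> 'a pair_pre_digraph \<Rightarrow> bool" where
  "is_union_of_cycles G K \<longleftrightarrow>
     (\<exists>C. (\<forall>c\<in>C. pre_digraph.cycle (with_proj G) c) \<and>
          K = \<lparr>pverts = (\<Union>c\<in>C. fst ` set c), parcs = (\<Union>c\<in>C. set c)\<rparr>)"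

definition ball_union :: "'a set pair_pre_digraph \<Rightarrow> 'a set" where
  "ball_union K = \<Union>(pverts K)"

end

theory Submission
  imports Defs
begin

text \<open>
  For \<open>s \<le> l\<close> the map \<open>f\<close> induces a self-map of the finite set of balls of radius \<open>p\<^sup>s\<close>, and unions
  of cycles correspond to sets of balls permuted by it. So the claim is that \<open>f\<close> preserves measure
  on \<open>Y\<close> iff it permutes the balls of radius \<open>p\<close> to the power \<open>t - 1\<close> in \<open>Y\<close>. If it preserves
  measure, each such ball has a preimage of positive measure, so it is hit, and a surjection of a
  finite set is a permutation. Conversely, if \<open>f\<close> separates the smaller balls inside a ball of
  radius \<open>p\<^sup>t\<close>, it cannot contract distances \<open>p\<^sup>t\<close>, so \<open>\<bar>f'\<bar> = 1\<close> on \<open>Y\<close> and \<open>f\<close> is an isometry on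
  the balls of radius \<open>p\<^sup>t\<close>. Hence \<open>f\<close> permutes the balls of every radius \<open>p\<^sup>s\<close> with \<open>s \<le> t\<close>: the
  preimage of a ball is a ball of the same radius, and these balls generate the Borel sets.
\<close>

section \<open>Cycles of functional digraphs\<close>

lemma cas_with_proj_verts:
  "pre_digraph.cas (with_proj G) u c v \<Longrightarrow> map fst c @ [v] = u # map snd c"
proof (induction c arbitrary: u)
  case Nil
  then show ?case by (simp add: pre_digraph.cas.simps)
next
  case (Cons e c)
  then show ?case by (auto simp: pre_digraph.cas.simps)
qed

text \<open>Along a closed walk at \<open>u\<close>, the list of tails and the list of heads differ
  only by moving \<open>u\<close> from the front to the end, and \<open>u\<close> occurs in
  both.\<close>

lemma cycle_fst_eq_snd:
  assumes "pre_digraph.cycle (with_proj G) c"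
  shows "fst ` set c = snd ` set c"
proof -
  obtain u where u: "pre_digraph.cas (with_proj G) u c u" "c \<noteq> []"
    using assms by (auto simp: pre_digraph.cycle_def pre_digraph.awalk_def)
  have eq: "map fst c @ [u] = u # map snd c" by (rule cas_with_proj_verts[OF u(1)])
  have "hd (map fst c @ [u]) = u" "last (u # map snd c) = u"
    by (simp only: eq list.sel) (simp flip: eq)
  hence "u \<in> set (map fst c)" "u \<in> set (map snd c)"
    using u(2) by (metis hd_append2 list.map_disc_iff list.set_sel(1),
        metis last.simps last_in_set list.map_disc_iff)
  moreover have "insert u (set (map fst c)) = insert u (set (map snd c))"
    using arg_cong[OF eq, of set] by simp
  ultimately show ?thesis by (simp add: insert_absorb)
qed

text \<open>Every arc leads from a vertex to its \<open>F\<close>-image, so \<open>F\<close> maps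
  the vertices of each cycle, hence of the union, onto themselves; on a finite set this forces
  injectivity.\<close>

lemma bij_betw_union_of_cycles:
  assumes "is_union_of_cycles G K"
    and arcs: "\<And>u v. (u, v) \<in> parcs G \<Longrightarrow> v = F u"
    and fin: "finite (pverts K)"
  shows "bij_betw F (pverts K) (pverts K)"
proof -
  obtain C where C: "\<And>c. c \<in> C \<Longrightarrow> pre_digraph.cycle (with_proj G) c"
    and K: "pverts K = (\<Union>c\<in>C. fst ` set c)"
    using assms(1) unfolding is_union_of_cycles_def by (metis pair_pre_digraph.select_convs(1))
  have F: "F ` fst ` set c = fst ` set c" if "c \<in> C" for c
  proof -
    have "set c \<subseteq> parcs G"
      using C[OF that] by (auto simp: pre_digraph.cycle_def pre_digraph.awalk_def)
    hence "F (fst e) = snd e" if "e \<in> set c" for e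
      using arcs[of "fst e" "snd e"] that by auto
    hence "F ` fst ` set c = snd ` set c" by (simp add: image_image cong: image_cong_simp)
    thus ?thesis by (simp add: cycle_fst_eq_snd[OF C[OF that]])
  qed
  have "F ` pverts K = pverts K" unfolding K image_UN using F by auto
  thus ?thesis using fin by (simp add: bij_betw_def eq_card_imp_inj_on)
qed

text \<open>The orbit of \<open>v\<close> in a finite set repeats; by injectivity it returns to
  \<open>v\<close> itself, and the orbit up to the first return is a cycle.\<close>

lemma orbit_cycle:
  assumes "finite W" "inj_on F W" "F ` W \<subseteq> W" "v \<in> W"
    and "\<And>w. w \<in> W \<Longrightarrow> w \<in> pverts G \<and> (w, F w) \<in> parcs G"
  obtains c where "pre_digraph.cycle (with_proj G) c" "v \<in> fst ` set c" "fst ` set c \<subseteq> W"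
proof -
  have W: "(F ^^ n) v \<in> W" for n using assms(3,4) by (induction n) auto
  \<comment> \<open>Injectivity allows common last applications of \<open>F\<close> to be cancelled.
    A collision at times \<open>i < j\<close> thus becomes a return to \<open>v\<close> at time
    \<open>j - i\<close>.\<close>
  have cancel: "(F ^^ m) v = (F ^^ n) v" if "(F ^^ (m + k)) v = (F ^^ (n + k)) v" for m n k
    using that
  proof (induction k)
    case (Suc k)
    thus ?case using inj_onD[OF assms(2) _ W W, of "m + k" "n + k"] by simp
  qed simp
  have "\<not> inj (\<lambda>n. (F ^^ n) v)"
    using finite_subset[OF _ assms(1), of "range (\<lambda>n. (F ^^ n) v)"] W
    by (auto dest: finite_imageD)
  then obtain i j where ij: "i < j" "(F ^^ i) v = (F ^^ j) v"
    unfolding inj_def by (metis linorder_neqE_nat)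
  have "0 < j - i \<and> (F ^^ (j - i)) v = v" using ij cancel[of 0 i "j - i"] by simp
  hence ex: "\<exists>n. 0 < n \<and> (F ^^ n) v = v" by blast
  define n where "n = (LEAST n. 0 < n \<and> (F ^^ n) v = v)"
  have n: "0 < n" "(F ^^ n) v = v" using LeastI_ex[OF ex] by (simp_all add: n_def)
  have least: "n \<le> k" if "0 < k" "(F ^^ k) v = v" for k
    unfolding n_def using that by (intro Least_le) simp
  \<comment> \<open>The range starts at 1 since \<open>v\<close> is both the first and the last
    vertex of the closed walk: a cycle requires distinctness only after the first one is
    dropped.\<close>
  have inj: "inj_on (\<lambda>k. (F ^^ k) v) {1..n}"
  proof (rule linorder_inj_onI')
    fix i j assume "i \<in> {1..n}" "j \<in> {1..n}" "i < j"
    thus "(F ^^ i) v \<noteq> (F ^^ j) v" using cancel[of 0 i "j - i"] least[of "j - i"] by force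
  qed
  \<comment> \<open>The walk of \<open>k\<close> arcs along the orbit from time \<open>i\<close>.
    The starting time varies because removing the first arc shifts it in the induction.\<close>
  define w where "w i k = map (\<lambda>i. ((F ^^ i) v, (F ^^ Suc i) v)) [i..<i + k]" for i k
  have w: "pre_digraph.cas (with_proj G) ((F ^^ i) v) (w i k) ((F ^^ (i + k)) v) \<and>
      pre_digraph.awalk_verts (with_proj G) ((F ^^ i) v) (w i k) =
        map (\<lambda>k. (F ^^ k) v) [i..<Suc (i + k)]" for i k
  proof (induction k arbitrary: i)
    case 0
    show ?case by (simp add: w_def pre_digraph.cas.simps pre_digraph.awalk_verts.simps)
  next
    case (Suc k)
    have "w i (Suc k) = ((F ^^ i) v, (F ^^ Suc i) v) # w (Suc i) k"
      by (simp add: w_def upt_conv_Cons del: upt_Suc)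
    moreover have "[i..<Suc (i + Suc k)] = i # [Suc i..<Suc (Suc i + k)]"
      by (simp add: upt_conv_Cons del: upt_Suc)
    ultimately show ?case using Suc.IH[of "Suc i"]
      by (simp add: pre_digraph.cas.simps pre_digraph.awalk_verts.simps del: upt_Suc)
  qed
  have "[0..<Suc n] = 0 # [1..<Suc n]" by (simp add: upt_conv_Cons del: upt_Suc)
  hence tl: "tl (map (\<lambda>k. (F ^^ k) v) [0..<Suc n]) = map (\<lambda>k. (F ^^ k) v) [1..<Suc n]"
    by (simp del: upt_Suc)
  have "pre_digraph.cycle (with_proj G) (w 0 n)"
    unfolding pre_digraph.cycle_def pre_digraph.awalk_def
  proof (intro exI[of _ v] conjI)
    show "v \<in> verts (with_proj G)" using assms(4,5) by simp
    show "set (w 0 n) \<subseteq> arcs (with_proj G)" using W assms(5) by (auto simp: w_def)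
    show "pre_digraph.cas (with_proj G) v (w 0 n) v" using w[of 0 n] n by simp
    have "distinct (map (\<lambda>k. (F ^^ k) v) [1..<Suc n])"
      using inj by (simp add: distinct_map atLeastLessThanSuc_atLeastAtMost del: upt_Suc)
    thus "distinct (tl (pre_digraph.awalk_verts (with_proj G) v (w 0 n)))"
      using w[of 0 n] by (simp add: tl del: upt_Suc)
    show "w 0 n \<noteq> []" using n by (simp add: w_def)
  qed
  moreover have "v \<in> fst ` set (w 0 n)"
    using n(1) by (auto simp: w_def image_image intro!: image_eqI[of _ _ 0])
  moreover have "fst ` set (w 0 n) \<subseteq> W" using W by (auto simp: w_def)
  ultimately show ?thesis by (rule that)
qed

lemma union_of_cycles_if_bij_betw:
  assumes "finite W" "bij_betw F W W"
    and "\<And>w. w \<in> W \<Longrightarrow> w \<in> pverts G \<and> (w, F w) \<in> parcs G"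
  obtains K where "is_union_of_cycles G K" "pverts K = W"
proof -
  \<comment> \<open>All cycles inside \<open>W\<close> are taken; \<open>orbit_cycle\<close> puts
    every point of \<open>W\<close> on one of them.\<close>
  define C where "C = {c. pre_digraph.cycle (with_proj G) c \<and> fst ` set c \<subseteq> W}"
  have "v \<in> (\<Union>c\<in>C. fst ` set c)" if "v \<in> W" for v
    using orbit_cycle[OF assms(1) _ _ that assms(3)] assms(2)
    by (metis (no_types, lifting) C_def UN_iff bij_betw_def mem_Collect_eq subset_refl)
  hence "(\<Union>c\<in>C. fst ` set c) = W" by (auto simp: C_def)
  moreover have "is_union_of_cycles G \<lparr>pverts = \<Union>c\<in>C. fst ` set c, parcs = \<Union>c\<in>C. set c\<rparr>"
    unfolding is_union_of_cycles_def by (intro exI[of _ C]) (simp add: C_def)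
  ultimately show ?thesis using that by fastforce
qed

section \<open>Balls in \<open>\<rat>\<^sub>p\<close>\<close>

abbreviation cell :: "int \<Rightarrow> 'p::prime_card padic \<Rightarrow> 'p padic set" where
  "cell s x \<equiv> cball x (real CARD('p) powi s)"

lemma CARD_gt_1: "real CARD('p::prime_card) > 1"
  using prime_gt_1_nat[OF prime_card[where 'a='p]] by simp

lemma powi_CARD_le: "s \<le> t \<Longrightarrow> real CARD('p::prime_card) powi s \<le> real CARD('p) powi t"
  using CARD_gt_1[where 'p='p] by (intro power_int_increasing) auto

lemma self_in_cell: "x \<in> cell s (x :: 'p::prime_card padic)"
  by simp

lemma cell_eq_iff: "cell s x = cell s y \<longleftrightarrow> x \<in> cell s (y :: 'p::prime_card padic)"
  using cball_padic_eq self_in_cell by metis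

lemma cell_mono:
  "y \<in> cell t x \<Longrightarrow> s \<le> t \<Longrightarrow> cell s y \<subseteq> cell t (x :: 'p::prime_card padic)"
  using cell_eq_iff powi_CARD_le subset_cball by metis

section \<open>Values of the norm and points at prescribed distances\<close>

text \<open>A rational closer to \<open>x\<close> than the norm of \<open>x\<close> has the same
  norm by the ultrametric inequality, and norms of nonzero rationals are powers of p.\<close>

lemma padic_norm_value:
  fixes x :: "'p::prime_card padic"
  assumes "x \<noteq> 0"
  obtains k where "\<bar>x\<bar>\<^sub>p = real CARD('p) powi k"
proof -
  have pos: "\<bar>x\<bar>\<^sub>p > 0" using assms by (simp add: order_less_le eq_commute[of 0])
  then obtain q where q: "dist x (of_rat q) < \<bar>x\<bar>\<^sub>p" using rat_dense_padic[of "\<bar>x\<bar>\<^sub>p" x] by blast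
  hence "\<bar>x - of_rat q\<bar>\<^sub>p < \<bar>x\<bar>\<^sub>p" "\<bar>of_rat q - x\<bar>\<^sub>p < \<bar>x\<bar>\<^sub>p"
    using padic_norm_minus[of "x - of_rat q"] by (simp_all add: dist_padic_def)
  hence eq: "\<bar>x\<bar>\<^sub>p = \<bar>of_rat q :: 'p padic\<bar>\<^sub>p"
    using padic_norm_add_le_max[of "x - of_rat q" "of_rat q"]
      padic_norm_add_le_max[of "of_rat q - x" x] by simp
  have "q \<noteq> 0" using eq assms padic_norm_eq_0_iff[of x] by auto
  thus ?thesis using eq that by (auto simp: padic_norm_of_rat padic_abs_def)
qed

text \<open>The norm takes no value strictly between consecutive powers of p. This is what makes a
  contraction at scale p^t visible on balls of radius p^(t-1).\<close>

lemma padic_norm_less_powi: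
  fixes x :: "'p::prime_card padic"
  assumes "\<bar>x\<bar>\<^sub>p < real CARD('p) powi t"
  shows "\<bar>x\<bar>\<^sub>p \<le> real CARD('p) powi (t - 1)"
proof (cases "x = 0")
  case False
  then obtain k where k: "\<bar>x\<bar>\<^sub>p = real CARD('p) powi k" by (rule padic_norm_value)
  have "k < t" using assms powi_CARD_le[of t k, where 'p='p] by (force simp: k)
  thus ?thesis by (simp add: k powi_CARD_le)
qed (simp add: padic_norm_eq_dist)

lemma padic_norm_powi_p: "\<bar>of_nat CARD('p) powi k :: 'p::prime_card padic\<bar>\<^sub>p = real CARD('p) powi (- k)"
proof -
  have p: "\<bar>of_nat CARD('p) :: 'p padic\<bar>\<^sub>p = inverse (real CARD('p))"
  proof -
    have "int CARD('p) \<noteq> 0" "\<not> is_unit (int CARD('p))"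
      using CARD_gt_1[where 'p='p] by auto
    hence "multiplicity (int CARD('p)) (int CARD('p)) = 1" by (rule multiplicity_self)
    hence "padic_abs CARD('p) (of_nat CARD('p)) = inverse (real CARD('p))"
      using padic_abs_of_int_div[OF prime_card[where 'a='p], of "int CARD('p)" 1]
      by (simp add: power_int_minus)
    thus ?thesis using padic_norm_of_rat[of "of_nat CARD('p)", where 'p='p] by simp
  qed
  have pow: "\<bar>x ^ n\<bar>\<^sub>p = \<bar>x\<bar>\<^sub>p ^ n" for x :: "'p padic" and n
    by (induction n) (simp_all add: padic_norm_mult)
  show ?thesis
    by (cases "k \<ge> 0")
      (simp_all add: power_int_def pow padic_norm_inverse p power_inverse[symmetric])
qed

text \<open>Supplies the test points at which the scaling factor of \<open>f\<close> is read off.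
  The witness is \<open>x\<close> minus p^(-s), since p^(-s) has norm p^s.\<close>

lemma exists_at_dist_powi:
  fixes x :: "'p::prime_card padic"
  obtains y where "dist x y = real CARD('p) powi s"
proof
  show "dist x (x - of_nat CARD('p) powi (- s)) = real CARD('p) powi s"
    by (simp only: dist_padic_def diff_diff_eq2 add_diff_cancel_left' padic_norm_powi_p minus_minus)
qed

lemma exists_powi_le:
  assumes "e > (0 :: real)"
  obtains s where "s \<le> t" "real CARD('p::prime_card) powi s \<le> e"
proof -
  have "inverse (real CARD('p)) < 1" using CARD_gt_1[where 'p='p] by (simp add: field_simps)
  then obtain n where n: "inverse (real CARD('p)) ^ n < e"
    using real_arch_pow_inv[OF assms] by blast
  have "real CARD('p) powi (- int n) < e" using n by (simp add: power_int_minus power_inverse)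
  moreover have "real CARD('p) powi min t (- int n) \<le> real CARD('p) powi (- int n)"
    by (rule powi_CARD_le) simp
  ultimately show ?thesis using that[of "min t (- int n)"] by simp
qed

section \<open>A countable basis of small balls\<close>

text \<open>Rational centres keep the family countable, the empty set makes it closed under
  intersection, and the bound \<open>t\<close> keeps only the radii for which preimages will be
  controlled.\<close>

definition rat_cells :: "int \<Rightarrow> 'p::prime_card padic set set" where
  "rat_cells t = insert {} {cell s (of_rat q) | s q. s \<le> t}"

lemma cell_in_rat_cells:
  fixes x :: "'p::prime_card padic"
  assumes "s \<le> t"
  shows "cell s x \<in> rat_cells t"
proof -
  obtain q where "dist x (of_rat q) < real CARD('p) powi s"
    using rat_dense_padic[OF real_CARD_powi_pos] by blast
  hence "cell s x = cell s (of_rat q)" by (simp add: cell_eq_iff dist_commute)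
  thus ?thesis using assms by (auto simp: rat_cells_def)
qed

lemma countable_rat_cells: "countable (rat_cells t :: 'p::prime_card padic set set)"
proof -
  have "rat_cells t \<subseteq> insert {} (range (\<lambda>(s, q). cell s (of_rat q :: 'p padic)))"
    by (auto simp: rat_cells_def)
  thus ?thesis by (rule countable_subset) simp
qed

lemma topological_basis_rat_cells: "topological_basis (rat_cells t :: 'p::prime_card padic set set)"
proof (rule topological_basisI)
  fix B :: "'p padic set" assume "B \<in> rat_cells t"
  thus "open B" by (auto simp: rat_cells_def intro: open_cball_padic)
next
  fix U and x :: "'p padic" assume "open U" "x \<in> U"
  then obtain e where e: "e > 0" "cball x e \<subseteq> U" by (auto simp: open_contains_cball)
  obtain s where "s \<le> t" "real CARD('p) powi s \<le> e" using exists_powi_le[OF e(1)] .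
  hence "cell s x \<in> rat_cells t" "cell s x \<subseteq> U" "x \<in> cell s x"
    using e(2) subset_cball[of "real CARD('p) powi s" e x] by (auto intro: cell_in_rat_cells)
  thus "\<exists>B\<in>rat_cells t. x \<in> B \<and> B \<subseteq> U" by blast
qed

text \<open>Two balls with a common point can both be centred there, so one contains the
  other.\<close>

lemma Int_stable_rat_cells: "Int_stable (rat_cells t :: 'p::prime_card padic set set)"
proof (rule Int_stableI)
  fix A B :: "'p padic set" assume AB: "A \<in> rat_cells t" "B \<in> rat_cells t"
  show "A \<inter> B \<in> rat_cells t"
  proof (cases "A \<inter> B = {}")
    case True thus ?thesis by (simp add: rat_cells_def)
  next
    case False
    then obtain z where z: "z \<in> A" "z \<in> B" by blast
    obtain r s a b where "A = cell r a" "B = cell s b" using AB z by (auto simp: rat_cells_def)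
    hence "A = cell r z" "B = cell s z" using z cell_eq_iff by blast+
    hence "A \<subseteq> B \<or> B \<subseteq> A" using cell_mono[OF self_in_cell] by (metis linear)
    thus ?thesis using AB by (auto simp: Int_absorb1 Int_absorb2)
  qed
qed

section \<open>Maps permuting small balls\<close>

text \<open>By uniqueness of measures it suffices to compare two pushforwards on a generating family
  closed under intersection, here the balls of radius at most p^t.\<close>

lemma measure_preserving_onI_cells:
  fixes Y :: "'p::prime_card padic set"
  assumes \<mu>: "is_haar_measure \<mu>" and Y: "open Y" and g: "continuous_on Y g" "g ` Y \<subseteq> Y"
    and sub: "\<And>s x. s \<le> t \<Longrightarrow> x \<in> Y \<Longrightarrow> cell s x \<subseteq> Y"
    and pre: "\<And>s y. s \<le> t \<Longrightarrow> y \<in> Y \<Longrightarrow> \<exists>x. g -` cell s y \<inter> Y = cell s x"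
  shows "measure_preserving_on \<mu> Y g"
proof -
  have sets: "sets \<mu> = sets borel" and vol: "emeasure \<mu> (cell s x) = ennreal (real CARD('p) powi s)" for s x
    using \<mu> by (auto simp: is_haar_measure_def)
  \<comment> \<open>The restriction of \<open>\<mu>\<close> to \<open>Y\<close>, pushed forward by
    \<open>g\<close> and by the inclusion. Both live on the whole field, so balls outside
    \<open>Y\<close> must be compared as well.\<close>
  define M where "M = distr (restrict_space \<mu> Y) borel g"
  define N where "N = distr (restrict_space \<mu> Y) borel (\<lambda>x. x)"
  have YM: "Y \<in> sets \<mu>" using Y by (simp add: sets)
  have space: "space \<mu> = UNIV" using sets_eq_imp_space_eq[OF sets] by simp
  have cong: "measurable (restrict_space \<mu> Y) borel = measurable (restrict_space borel Y) (borel :: 'p padic measure)"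
    by (intro measurable_cong_sets sets_restrict_space_cong sets refl)
  have gm: "g \<in> measurable (restrict_space \<mu> Y) borel"
    unfolding cong by (rule borel_measurable_continuous_on_restrict[OF g(1)])
  have im: "(\<lambda>x. x) \<in> measurable (restrict_space \<mu> Y) borel"
    unfolding cong by (intro borel_measurable_continuous_on_restrict continuous_intros)
  have eM: "emeasure M A = emeasure \<mu> (g -` A \<inter> Y)"
    and eN: "emeasure N A = emeasure \<mu> (A \<inter> Y)" if "A \<in> sets borel" for A
    using that gm im YM
    by (simp_all add: M_def N_def emeasure_distr space_restrict_space space emeasure_restrict_space)
  have cells: "emeasure M (cell s x) = emeasure N (cell s x) \<and> emeasure M (cell s x) \<noteq> \<infinity>"
    if s: "s \<le> t" for s x
  proof (cases "cell s x \<inter> Y = {}")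
    case True
    hence "g -` cell s x \<inter> Y = {}" using g(2) by auto
    thus ?thesis using True by (simp add: eM eN)
  next
    case False
    then obtain y where y: "y \<in> Y" "cell s x = cell s y" using cell_eq_iff by blast
    \<comment> \<open>The centre \<open>z\<close> does not matter: Haar measure of a ball depends
      only on its radius.\<close>
    obtain z where "g -` cell s x \<inter> Y = cell s z" using pre[OF s y(1)] y(2) by auto
    moreover have "cell s x \<inter> Y = cell s x" using sub[OF s y(1)] y(2) by auto
    ultimately show ?thesis by (simp add: eM eN vol)
  qed
  have borel: "sets (borel :: 'p padic measure) = sigma_sets UNIV (rat_cells t)"
    using borel_eq_countable_basis[OF countable_rat_cells topological_basis_rat_cells, of t]
    by (metis Pow_UNIV sets_measure_of top_greatest)
  have "M = N"
  proof (rule measure_eqI_generator_eq_countable)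
    show "Int_stable (rat_cells t :: 'p padic set set)" by (rule Int_stable_rat_cells)
    show "rat_cells t \<subseteq> Pow (UNIV :: 'p padic set)" by simp
    show "emeasure M A = emeasure N A" if "A \<in> rat_cells t" for A
      using that cells by (auto simp: rat_cells_def)
    show "sets M = sigma_sets UNIV (rat_cells t)" "sets N = sigma_sets UNIV (rat_cells t)"
      by (simp_all add: M_def N_def borel)
    show "rat_cells t \<subseteq> (rat_cells t :: 'p padic set set)" ..
    show "\<Union> (rat_cells t) = (UNIV :: 'p padic set)"
      using cell_in_rat_cells[OF order_refl] self_in_cell by blast
    show "countable (rat_cells t :: 'p padic set set)" by (rule countable_rat_cells)
    show "emeasure M A \<noteq> \<infinity>" if "A \<in> rat_cells t" for A
      using that cells by (auto simp: rat_cells_def)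
  qed
  show ?thesis
    unfolding measure_preserving_on_def
  proof (intro conjI ballI impI g(2))
    fix A :: "'p padic set" assume A: "A \<in> sets borel" "A \<subseteq> Y"
    show "emeasure \<mu> (g -` A \<inter> Y) = emeasure \<mu> A"
      using eM[OF A(1)] eN[OF A(1)] A(2) \<open>M = N\<close> by (simp add: Int_absorb2)
    have "g -` A \<inter> Y \<in> sets (restrict_space \<mu> Y)"
      using measurable_sets[OF gm A(1)] by (simp add: space_restrict_space space)
    thus "g -` A \<inter> Y \<in> sets borel"
      using YM by (simp add: sets_restrict_space_iff space sets)
  qed
qed

lemma ballsE:
  assumes "D \<in> balls (Y :: 'p::prime_card padic set) s"
  obtains x where "x \<in> Y" "D = cell s x" "cell s x \<subseteq> Y"
proof -
  obtain x where "D \<subseteq> Y" "D = cell s x" using assms by (auto simp: balls_def)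
  thus ?thesis using that[of x] self_in_cell by blast
qed

text \<open>The chosen point is immaterial when \<open>g\<close> maps all of \<open>D\<close> into a
  single ball of radius p^s; \<open>cell_map_cell\<close> verifies independence for
  \<open>f\<close>.\<close>

definition cell_map :: "int \<Rightarrow> ('p::prime_card padic \<Rightarrow> 'p padic) \<Rightarrow> 'p padic set \<Rightarrow> 'p padic set" where
  "cell_map s g D = cell s (g (SOME x. x \<in> D))"

section \<open>The map induced by \<open>f\<close> on balls\<close>

locale padic_dynamics =
  fixes X :: "'p::prime_card padic set" and P Q :: "'p padic poly" and l :: int
  assumes compact: "compact X"
    and self_map: "rational_self_map P Q X"
    and lipschitz: "locally_1_lipschitz X (rat_fun P Q)"
    and adm: "admissible P Q X l"
begin

abbreviation f where "f \<equiv> rat_fun P Q"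
abbreviation f' where "f' \<equiv> rat_fun_deriv P Q"

lemma f_in: "x \<in> X \<Longrightarrow> f x \<in> X"
  using self_map by (auto simp: rational_self_map_def)

lemma cell_sub: "x \<in> X \<Longrightarrow> s \<le> l \<Longrightarrow> cell s x \<subseteq> X"
  using adm cell_mono[OF self_in_cell, of s l x] unfolding admissible_def by blast

lemma dist_f:
  assumes "a \<in> X" "x \<in> cell l a" "y \<in> cell l a"
  shows "dist (f x) (f y) = \<bar>f' a\<bar>\<^sub>p * dist x y"
  using adm assms by (simp add: admissible_def dist_padic_def)

text \<open>Admissibility makes the norm of \<open>f' a\<close> the exact scaling factor near
  \<open>a\<close>. One point \<open>y\<close> other than \<open>a\<close>, within both p^l and the
  Lipschitz radius, bounds it.\<close>

lemma norm_f'_le_1: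
  assumes a: "a \<in> X"
  shows "\<bar>f' a\<bar>\<^sub>p \<le> 1"
proof -
  obtain r where r: "r > 0" "\<And>x y. x \<in> cball a r \<inter> X \<Longrightarrow> y \<in> cball a r \<inter> X \<Longrightarrow> \<bar>f x - f y\<bar>\<^sub>p \<le> \<bar>x - y\<bar>\<^sub>p"
    using lipschitz a unfolding locally_1_lipschitz_def by blast
  obtain s where s: "s \<le> l" "real CARD('p) powi s \<le> r" using exists_powi_le[OF r(1)] .
  obtain y where y: "dist a y = real CARD('p) powi s" by (rule exists_at_dist_powi)
  have yl: "y \<in> cell l a" using y powi_CARD_le[OF s(1), where 'p='p] by simp
  have "dist (f a) (f y) \<le> dist a y"
    using r(2)[of a y] r(1) y s(2) a subsetD[OF cell_sub[OF a order_refl] yl]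
    by (simp add: dist_padic_def)
  hence "\<bar>f' a\<bar>\<^sub>p * dist a y \<le> 1 * dist a y" using dist_f[OF a self_in_cell yl] by simp
  thus ?thesis by (rule mult_right_le_imp_le) (simp add: y)
qed

lemma dist_f_le:
  assumes "x \<in> X" "y \<in> cell l x"
  shows "dist (f x) (f y) \<le> dist x y"
  using dist_f[OF assms(1) self_in_cell assms(2)] norm_f'_le_1[OF assms(1)]
  by (simp add: mult_left_le_one_le)

lemma continuous_f: "continuous_on X f"
  unfolding continuous_on_iff
proof (intro ballI allI impI)
  fix x e assume x: "x \<in> X" and "(e :: real) > 0"
  then have "min e (real CARD('p) powi l) > 0" by simp
  moreover have "dist (f y) (f x) < e" if "dist y x < min e (real CARD('p) powi l)" for y
    using dist_f_le[OF x, of y] that by (simp add: dist_commute)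
  ultimately show "\<exists>d>0. \<forall>y\<in>X. dist y x < d \<longrightarrow> dist (f y) (f x) < e" by blast
qed

lemma image_cell:
  assumes "x \<in> X" "s \<le> l"
  shows "f ` cell s x \<subseteq> cell s (f x)"
proof
  fix z assume "z \<in> f ` cell s x"
  then obtain y where y: "y \<in> cell s x" "z = f y" by blast
  hence "y \<in> cell l x" using cell_mono[OF self_in_cell assms(2)] by blast
  thus "z \<in> cell s (f x)" using dist_f_le[OF assms(1)] y by fastforce
qed

lemma cell_map_cell:
  assumes "x \<in> X" "s \<le> l"
  shows "cell_map s f (cell s x) = cell s (f x)"
proof -
  have "(SOME y. y \<in> cell s x) \<in> cell s x" using self_in_cell by (rule someI)
  thus ?thesis using image_cell[OF assms] unfolding cell_map_def cell_eq_iff by blast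
qed

text \<open>Since \<open>f\<close> does not expand distances up to p^l, the image of a ball lies in
  one ball of the same radius, unique because balls of equal radius that meet coincide. So the
  digraph is the graph of \<open>cell_map s f\<close>.\<close>

lemma parcs_ball_digraph:
  assumes "s \<le> l"
  shows "(D, E) \<in> parcs (ball_digraph P Q X s) \<longleftrightarrow> D \<in> balls X s \<and> E = cell_map s f D"
proof -
  have "E \<in> balls X s \<and> f ` D \<subseteq> E \<longleftrightarrow> E = cell_map s f D" if D: "D \<in> balls X s"
  proof -
    obtain x where x: "x \<in> X" "D = cell s x" using D by (rule ballsE)
    have "cell s (f x) \<in> balls X s"
      using cell_sub[OF f_in[OF x(1)] assms] by (auto simp: balls_def)
    moreover have "E = cell s (f x)" if "E \<in> balls X s" "f ` D \<subseteq> E"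
    proof -
      have "f x \<in> E" using that(2) x(2) self_in_cell by blast
      thus ?thesis using that(1) cell_eq_iff by (metis ballsE)
    qed
    ultimately show ?thesis using x image_cell[OF x(1) assms] cell_map_cell[OF x(1) assms] by auto
  qed
  thus ?thesis by (auto simp: ball_digraph_def)
qed

text \<open>Balls of one radius are pairwise disjoint, so the vertices can be recovered from their
  union. Conditions on \<open>K\<close> thereby become conditions on the set
  \<open>ball_union K\<close>.\<close>

lemma pverts_union_of_cycles:
  assumes s: "s \<le> l" and K: "is_union_of_cycles (ball_digraph P Q X s) K"
  shows "pverts K = balls (ball_union K) s"
    and "bij_betw (cell_map s f) (balls (ball_union K) s) (balls (ball_union K) s)"
    and "ball_union K \<subseteq> X"
proof -
  have sub: "pverts K \<subseteq> balls X s"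
  proof
    fix D assume "D \<in> pverts K"
    then obtain c E where "pre_digraph.cycle (with_proj (ball_digraph P Q X s)) c" "(D, E) \<in> set c"
      using K by (fastforce simp: is_union_of_cycles_def)
    hence "(D, E) \<in> parcs (ball_digraph P Q X s)"
      by (auto simp: pre_digraph.cycle_def pre_digraph.awalk_def)
    thus "D \<in> balls X s" by (simp add: ball_digraph_def)
  qed
  have "D \<subseteq> X" if "D \<in> pverts K" for D
    using subsetD[OF sub that] by (simp add: balls_def)
  thus "ball_union K \<subseteq> X" unfolding ball_union_def by (rule Union_least)
  \<comment> \<open>Prepares \<open>balls_unique\<close>: a partition into balls of radius p^s must
    consist of all such balls in the set.\<close>
  have part: "partition_on (ball_union K) (pverts K)"
    unfolding ball_union_def
  proof (rule partition_onI)
    note part = partition_on_balls[OF adm s]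
    show "disjnt D E" if "D \<in> pverts K" "E \<in> pverts K" "D \<noteq> E" for D E
      using pairwiseD[OF partition_onD2[OF part]] subsetD[OF sub] that by blast
    show "{} \<notin> pverts K" using partition_onD3[OF part] sub by blast
  qed (rule refl)
  show eq: "pverts K = balls (ball_union K) s"
    using sub by (intro balls_unique[OF part]) (auto simp: balls_def)
  show "bij_betw (cell_map s f) (balls (ball_union K) s) (balls (ball_union K) s)"
    unfolding eq[symmetric]
  proof (rule bij_betw_union_of_cycles[OF K])
    show "finite (pverts K)" using finite_subset[OF sub finite_balls[OF compact adm s]] .
  qed (simp add: parcs_ball_digraph[OF s])
qed

text \<open>Level \<open>t - 1\<close> is the first at which shrinking inside a ball of radius p^t
  shows up as a collision of balls. Without shrinking, \<open>f\<close> is an isometry there and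
  permutes balls at all finer levels.\<close>

lemma measure_preserving_iff_bij:
  assumes \<mu>: "is_haar_measure \<mu>" and t: "t \<le> l" and YX: "Y \<subseteq> X"
    and Y: "\<And>x. x \<in> Y \<Longrightarrow> cell t x \<subseteq> Y"
    and bij: "bij_betw (cell_map t f) (balls Y t) (balls Y t)"
  shows "measure_preserving_on \<mu> Y f \<longleftrightarrow>
           bij_betw (cell_map (t - 1) f) (balls Y (t - 1)) (balls Y (t - 1))"
proof -
  have sub: "cell s x \<subseteq> Y" if "s \<le> t" "x \<in> Y" for s x
    using Y[OF that(2)] cell_mono[OF self_in_cell that(1), of x] by blast
  have cell_in: "cell s x \<in> balls Y s" if "s \<le> t" "x \<in> Y" for s x
    using sub[OF that] by (auto simp: balls_def)
  have map: "cell_map s f (cell s x) = cell s (f x)" if "s \<le> t" "x \<in> Y" for s x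
    using that t YX by (intro cell_map_cell) auto
  have fin: "finite (balls Y s)" if "s \<le> t" for s
  proof (rule finite_subset)
    show "balls Y s \<subseteq> balls X s" using YX by (auto simp: balls_def)
    show "finite (balls X s)" using that t by (intro finite_balls[OF compact adm]) simp
  qed
  have fY: "f x \<in> Y" if "x \<in> Y" for x
  proof -
    have "cell t (f x) \<in> balls Y t"
      using bij_betwE[OF bij] cell_in[OF order_refl that] map[OF order_refl that] by metis
    thus ?thesis using self_in_cell by (auto simp: balls_def)
  qed
  have into: "cell_map s f ` balls Y s \<subseteq> balls Y s" if s: "s \<le> t" for s
  proof (rule image_subsetI)
    fix D assume "D \<in> balls Y s"
    then obtain x where "x \<in> Y" "D = cell s x" by (rule ballsE)
    thus "cell_map s f D \<in> balls Y s" using map[OF s] cell_in[OF s] fY by simp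
  qed
  show ?thesis
  proof
    assume mp: "measure_preserving_on \<mu> Y f"
    have "balls Y (t - 1) \<subseteq> cell_map (t - 1) f ` balls Y (t - 1)"
    proof
      fix E assume "E \<in> balls Y (t - 1)"
      then obtain y where y: "E = cell (t - 1) y" "E \<subseteq> Y" by (metis ballsE)
      have "E \<in> sets borel" using y(1) by (simp add: open_cball_padic)
      hence "emeasure \<mu> (f -` E \<inter> Y) = emeasure \<mu> E"
        using mp y(2) by (simp add: measure_preserving_on_def)
      also have "\<dots> = ennreal (real CARD('p) powi (t - 1))"
        using \<mu> y(1) by (simp add: is_haar_measure_def)
      \<comment> \<open>The empty set has measure 0, while p^(t-1) is positive.\<close>
      finally have "f -` E \<inter> Y \<noteq> {}" by auto
      then obtain x where x: "x \<in> Y" "f x \<in> E" by blast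
      hence "E = cell_map (t - 1) f (cell (t - 1) x)" using map[of "t - 1" x] y(1) cell_eq_iff[where s = "t - 1" and x = "f x" and y = y] by simp
      thus "E \<in> cell_map (t - 1) f ` balls Y (t - 1)" using cell_in[of "t - 1" x] x(1) by simp
    qed
    hence "cell_map (t - 1) f ` balls Y (t - 1) = balls Y (t - 1)" using into[of "t - 1"] by simp
    thus "bij_betw (cell_map (t - 1) f) (balls Y (t - 1)) (balls Y (t - 1))"
      using fin[of "t - 1"] by (simp add: bij_betw_def eq_card_imp_inj_on)
  next
    assume bij1: "bij_betw (cell_map (t - 1) f) (balls Y (t - 1)) (balls Y (t - 1))"
    have inj: "x \<in> cell s y" if "bij_betw (cell_map s f) (balls Y s) (balls Y s)" "s \<le> t"
      "x \<in> Y" "y \<in> Y" "f x \<in> cell s (f y)" for s x y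
    proof -
      have "cell_map s f (cell s x) = cell_map s f (cell s y)"
        using that map cell_eq_iff by metis
      hence "cell s x = cell s y"
        using bij_betw_imp_inj_on[OF that(1)] cell_in that by (auto dest: inj_onD)
      thus ?thesis by (simp only: cell_eq_iff)
    qed
    have norm_1: "\<bar>f' x\<bar>\<^sub>p = 1" if x: "x \<in> Y" for x
    proof (rule ccontr)
      have xX: "x \<in> X" using x YX by blast
      assume "\<bar>f' x\<bar>\<^sub>p \<noteq> 1"
      hence less: "\<bar>f' x\<bar>\<^sub>p < 1" using norm_f'_le_1[OF xX] by simp
      \<comment> \<open>This \<open>y\<close> shares the ball of radius p^t with \<open>x\<close>,
        but not the one of radius p^(t-1). If \<open>f\<close> shrank the distance, discreteness of
        the norm would put both images in one ball of radius p^(t-1), against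
        \<open>bij1\<close>.\<close>
      obtain y where y: "dist x y = real CARD('p) powi t" by (rule exists_at_dist_powi)
      have yl: "y \<in> cell l x" using y powi_CARD_le[OF t, where 'p='p] by simp
      have yY: "y \<in> Y" using Y[OF x] y by auto
      have "dist (f x) (f y) < real CARD('p) powi t"
        using less dist_f[OF xX self_in_cell yl] by (simp add: y)
      hence "f x \<in> cell (t - 1) (f y)"
        by (simp add: dist_commute[of "f y"]) (simp add: dist_padic_def padic_norm_less_powi)
      hence "dist x y \<le> real CARD('p) powi (t - 1)"
        using inj[OF bij1 _ x yY] by (simp add: dist_commute)
      also have "\<dots> < real CARD('p) powi t"
        using CARD_gt_1[where 'p='p] by (intro power_int_strict_increasing) auto
      finally show False by (simp add: y)
    qed
    \<comment> \<open>Injectivity at level \<open>t\<close> first brings \<open>x\<close> and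
      \<open>y\<close> into a common ball of radius p^t, where \<open>f\<close> scales distances by
      the norm of \<open>f' y\<close>, which is 1.\<close>
    have isometry: "dist x y = dist (f x) (f y)"
      if "x \<in> Y" "y \<in> Y" "f x \<in> cell t (f y)" for x y
    proof -
      have "x \<in> cell t y" by (rule inj[OF bij order_refl that])
      hence "x \<in> cell l y" using cell_mono[OF self_in_cell t] by blast
      thus ?thesis using dist_f[OF _ _ self_in_cell, of y x] norm_1[OF that(2)] that(2) YX by auto
    qed
    have bijs: "bij_betw (cell_map s f) (balls Y s) (balls Y s)" if s: "s \<le> t" for s
    proof -
      have "inj_on (cell_map s f) (balls Y s)"
      proof (rule inj_onI)
        fix D E assume "D \<in> balls Y s" "E \<in> balls Y s" and eq: "cell_map s f D = cell_map s f E"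
        then obtain x y where xy: "x \<in> Y" "D = cell s x" "y \<in> Y" "E = cell s y" by (metis ballsE)
        hence fs: "f x \<in> cell s (f y)" using eq map[OF s] cell_eq_iff by metis
        hence "f x \<in> cell t (f y)" using cell_mono[OF self_in_cell s] by blast
        hence "dist x y = dist (f x) (f y)" using isometry xy by blast
        hence "x \<in> cell s y" using fs by (simp add: dist_commute)
        thus "D = E" using xy cell_eq_iff by blast
      qed
      thus ?thesis using into[OF s] fin[OF s] by (simp add: bij_betw_def endo_inj_surj)
    qed
    show "measure_preserving_on \<mu> Y f"
    proof (rule measure_preserving_onI_cells[OF \<mu>])
      show "open Y"
        unfolding open_contains_cball using Y real_CARD_powi_pos by blast
      show "continuous_on Y f" using continuous_f YX by (rule continuous_on_subset)
      show "f ` Y \<subseteq> Y" using fY by blast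
      show "cell s x \<subseteq> Y" if "s \<le> t" "x \<in> Y" for s x using sub[OF that] .
      fix s y assume s: "s \<le> t" and y: "y \<in> Y"
      have "cell s y \<in> cell_map s f ` balls Y s"
        using cell_in[OF s y] bij_betw_imp_surj_on[OF bijs[OF s]] by simp
      then obtain D where D: "D \<in> balls Y s" "cell s y = cell_map s f D" by blast
      obtain x where x: "x \<in> Y" "D = cell s x" using D(1) by (rule ballsE)
      hence fx: "cell s (f x) = cell s y" using D(2) map[OF s] by simp
      \<comment> \<open>One inclusion is injectivity on balls of radius p^s, the other that
        \<open>f\<close> does not expand distances.\<close>
      have "f -` cell s (f x) \<inter> Y = cell s x"
      proof (intro equalityI subsetI)
        fix z assume "z \<in> f -` cell s (f x) \<inter> Y"
        thus "z \<in> cell s x" using inj[OF bijs[OF s] s _ x(1)] by blast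
      next
        fix z assume "z \<in> cell s x"
        thus "z \<in> f -` cell s (f x) \<inter> Y"
          using image_cell[OF subsetD[OF YX x(1)] order_trans[OF s t]] sub[OF s x(1)] by blast
      qed
      thus "\<exists>x. f -` cell s y \<inter> Y = cell s x" unfolding fx by blast
    qed
  qed
qed

end

section \<open>From permutations of balls back to unions of cycles\<close>

theorem proposition4p8:
  fixes X Y :: "'p::prime_card padic set"
    and P Q :: "'p padic poly"
    and l t0 t :: int
    and a :: "int \<Rightarrow> 'p padic set \<Rightarrow> 'p padic"
    and K :: "'p padic set pair_pre_digraph"
    and \<mu> :: "'p padic measure"
  assumes "is_haar_measure \<mu>"
    and "compact X" and "open X"
    and "rational_self_map P Q X"
    and "locally_1_lipschitz X (rat_fun P Q)"
    and "\<forall>x\<in>X. rat_fun_deriv P Q x \<noteq> 0"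
    and "admissible P Q X l"
    and "is_representatives X l a"
    and "is_intrinsic_level P Q X l a t0"
    and "t \<le> t0"
    and "is_union_of_cycles (ball_digraph P Q X t) K"
    and "Y = ball_union K"
  shows "measure_preserving_on \<mu> Y (rat_fun P Q) \<longleftrightarrow>
           (\<exists>K'. is_union_of_cycles (ball_digraph P Q X (t - 1)) K' \<and> Y = ball_union K')"
proof -
  interpret padic_dynamics X P Q l using assms by unfold_locales
  have t: "t \<le> l" "t - 1 \<le> l" using assms(9,10) by (simp_all add: is_intrinsic_level_def)
  note K = pverts_union_of_cycles[OF t(1) assms(11), folded assms(12)]
  have cell_Y: "cell t x \<subseteq> Y" if "x \<in> Y" for x
  proof -
    have "x \<in> ball_union K" using that by (rule subst[OF assms(12)])
    hence "x \<in> \<Union> (balls Y t)" unfolding ball_union_def K(1) .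
    then obtain D where D: "D \<in> balls Y t" "x \<in> D" by (rule UnionE)
    obtain y where y: "D = cell t y" "cell t y \<subseteq> Y" using D(1) by (rule ballsE)
    have "x \<in> cell t y" using D(2) unfolding y(1) .
    thus ?thesis using cell_mono[OF _ order_refl] y(2) by blast
  qed
  \<comment> \<open>What remains is combinatorial: permuting the balls of radius p^(t-1) in
    \<open>Y\<close> is the same as covering \<open>Y\<close> exactly by cycles at that
    level.\<close>
  have "bij_betw (cell_map (t - 1) f) (balls Y (t - 1)) (balls Y (t - 1)) \<longleftrightarrow>
      (\<exists>K'. is_union_of_cycles (ball_digraph P Q X (t - 1)) K' \<and> Y = ball_union K')" (is "?B \<longleftrightarrow> ?C")
  proof
    assume bij: ?B
    have sub: "balls Y (t - 1) \<subseteq> balls X (t - 1)" using K(3) by (auto simp: balls_def)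
    obtain K' where K': "is_union_of_cycles (ball_digraph P Q X (t - 1)) K'" "pverts K' = balls Y (t - 1)"
    proof (rule union_of_cycles_if_bij_betw[OF _ bij])
      show "finite (balls Y (t - 1))"
        using finite_subset[OF sub finite_balls[OF compact adm t(2)]] .
      show "w \<in> pverts (ball_digraph P Q X (t - 1)) \<and>
          (w, cell_map (t - 1) f w) \<in> parcs (ball_digraph P Q X (t - 1))" if "w \<in> balls Y (t - 1)" for w
        using that sub unfolding parcs_ball_digraph[OF t(2)] by (auto simp: ball_digraph_def)
    qed
    \<comment> \<open>\<open>Y\<close> is a union of balls of radius p^t, so it contains the smaller
      ball around each of its points; hence the vertices of \<open>K'\<close> cover
      \<open>Y\<close>.\<close>
    have "cell (t - 1) x \<in> balls Y (t - 1)" if "x \<in> Y" for x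
      using cell_Y[OF that] cell_mono[OF self_in_cell, of "t - 1" t x] by (auto simp: balls_def)
    hence "Y \<subseteq> ball_union K'" unfolding ball_union_def K'(2) using self_in_cell by blast
    moreover have "ball_union K' \<subseteq> Y" by (auto simp: ball_union_def K'(2) balls_def)
    ultimately have "Y = ball_union K'" by simp
    thus ?C using K'(1) by blast
  next
    assume ?C
    then obtain K' where K': "is_union_of_cycles (ball_digraph P Q X (t - 1)) K'" "Y = ball_union K'"
      by blast
    show ?B unfolding K'(2) by (rule pverts_union_of_cycles(2)[OF t(2) K'(1)])
  qed
  with measure_preserving_iff_bij[OF assms(1) t(1) K(3) cell_Y K(2)] show ?thesis by (rule trans)
qed

end
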